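(* Let $n \ge 2$. Then the virtual cactus group $\mathrm{VJ}_n$ has a solution to the word problem; that is, there is an algorithm which, given a word in the generators $x_{p,q}$ ($1\le p<q\le n$), $\rho_i$ ($1\le i\le n-1$) and their inverses, decides whether it represents the trivial element of $\mathrm{VJ}_n$.
   Context: $\mathrm{VJ}_n$ is the group with generators $x_{p,q}$ ($1\le p<q\le n$) and $\rho_i$ ($1\le i\le n-1$) and relations: (j1) $x_{p,q}^2=1$ for $1\le p<q\le n$; (j2) $x_{p,q}x_{m,r}=x_{m,r}x_{p,q}$ if $[p,q]\cap[m,r]=\emptyset$; (j3) $x_{p,q}x_{m,r}=x_{p+q-r,p+q-m}x_{p,q}$ if $[m,r]\subset[p,q]$; (s1) $\rho_i^2=1$ for $1\le i\le n-1$; (s2) $\rho_i\rho_j\rho_i=\rho_j\rho_i\rho_j$ if $|i-j|=1$; (s3) $\rho_i\rho_j=\rho_j\rho_i$ if $|i-j|>1$; (m1) $\rho_ix_{p,q}=x_{p,q}\rho_i$ for $i<p-1$ and for $i\ge q+1$; (m2) $x_{p,q}\rho_q\rho_{q-1}\cdots\rho_p=\rho_q\rho_{q-1}\cdots\rho_p\,x_{p+1,q+1}$ for $1\le p<q<n$. *)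

theory Defs
  imports "HOL-Algebra.Group" "HOL-Library.Nat_Bijection"
begin

section \<open>Groups given by generators and relations\<close>

text \<open>
  A word is a list of letters; \<open>(g, True)\<close> stands for the generator \<open>g\<close> and
  \<open>(g, False)\<close> for its formal inverse. Words are not assumed to be freely reduced.
\<close>

type_synonym 'g word = "('g \<times> bool) list"

definition words :: "'g set \<Rightarrow> 'g word set"
  where "words S = lists (S \<times> UNIV)"

inductive pres_eq :: "'g set \<Rightarrow> ('g word \<times> 'g word) set \<Rightarrow> 'g word \<Rightarrow> 'g word \<Rightarrow> bool"
  for S R where
  rel: "(u, v) \<in> R \<Longrightarrow> u \<in> words S \<Longrightarrow> v \<in> words S \<Longrightarrow> pres_eq S R u v"
| cancel: "g \<in> S \<Longrightarrow> pres_eq S R [(g, b), (g, \<not> b)] []"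
| refl: "u \<in> words S \<Longrightarrow> pres_eq S R u u"
| sym: "pres_eq S R u v \<Longrightarrow> pres_eq S R v u"
| trans: "pres_eq S R u v \<Longrightarrow> pres_eq S R v w \<Longrightarrow> pres_eq S R u w"
| cong: "pres_eq S R u u' \<Longrightarrow> pres_eq S R v v' \<Longrightarrow> pres_eq S R (u @ v) (u' @ v')"

definition word_class :: "'g set \<Rightarrow> ('g word \<times> 'g word) set \<Rightarrow> 'g word \<Rightarrow> 'g word set"
  where "word_class S R w = {v. pres_eq S R w v}"

definition pres_group :: "'g set \<Rightarrow> ('g word \<times> 'g word) set \<Rightarrow> 'g word set monoid"
  where "pres_group S R =
    \<lparr>carrier = word_class S R ` words S,
     mult = (\<lambda>A B. {w. \<exists>u\<in>A. \<exists>v\<in>B. pres_eq S R (u @ v) w}),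
     one = word_class S R []\<rparr>"

lemma pres_eq_words: "pres_eq S R u v \<Longrightarrow> u \<in> words S \<and> v \<in> words S"
  by (induction rule: pres_eq.induct) (auto simp: words_def)

lemma word_class_eq_iff:
  assumes "u \<in> words S"
  shows "word_class S R u = word_class S R v \<longleftrightarrow> pres_eq S R u v"
proof
  assume "word_class S R u = word_class S R v"
  moreover have "u \<in> word_class S R u" using assms by (simp add: word_class_def pres_eq.refl)
  ultimately show "pres_eq S R u v" by (simp add: word_class_def pres_eq.sym)
next
  assume "pres_eq S R u v"
  then show "word_class S R u = word_class S R v"
    unfolding word_class_def by (blast intro: pres_eq.sym pres_eq.trans)
qed

lemma pres_group_mult:
  assumes "u \<in> words S" "v \<in> words S"
  shows "word_class S R u \<otimes>\<^bsub>pres_group S R\<^esub> word_class S R v = word_class S R (u @ v)"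
proof -
  have "(\<exists>u'. pres_eq S R u u' \<and> (\<exists>v'. pres_eq S R v v' \<and> pres_eq S R (u' @ v') w)) \<longleftrightarrow>
      pres_eq S R (u @ v) w" for w
    using assms by (meson pres_eq.refl pres_eq.cong pres_eq.trans)
  then show ?thesis by (simp add: pres_group_def word_class_def)
qed

lemma pres_group_is_group: "group (pres_group S R)"
proof -
  let ?G = "pres_group S R" and ?c = "word_class S R"
  define bar :: "'a word \<Rightarrow> 'a word" where "bar w = rev (map (apsnd Not) w)" for w
  have car: "carrier ?G = ?c ` words S" and one: "\<one>\<^bsub>?G\<^esub> = ?c []"
    by (auto simp: pres_group_def)
  have app: "u @ v \<in> words S" if "u \<in> words S" "v \<in> words S" for u v
    using that by (auto simp: words_def)
  have nil: "[] \<in> words S" by (auto simp: words_def)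
  have bar: "bar w \<in> words S \<and> pres_eq S R (bar w @ w) []" if "w \<in> words S" for w
    using that
  proof (induction w)
    case Nil
    then show ?case by (simp add: bar_def pres_eq.refl)
  next
    case (Cons a w)
    obtain g b where a: "a = (g, b)" by force
    have g: "g \<in> S" and w: "w \<in> words S" using Cons.prems by (auto simp: words_def a)
    note IH = Cons.IH[OF w]
    have "pres_eq S R [(g, \<not> b), (g, b)] []"
      using pres_eq.cancel[OF g, of R "\<not> b"] by simp
    then have "pres_eq S R ([(g, \<not> b), (g, b)] @ w) ([] @ w)"
      by (rule pres_eq.cong[OF _ pres_eq.refl[OF w]])
    then have "pres_eq S R (bar w @ ([(g, \<not> b), (g, b)] @ w)) (bar w @ ([] @ w))"
      using pres_eq.cong[OF pres_eq.refl] IH by blast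
    then have "pres_eq S R (bar (a # w) @ (a # w)) (bar w @ w)"
      by (simp add: bar_def a)
    then have "pres_eq S R (bar (a # w) @ (a # w)) []"
      using IH by (blast intro: pres_eq.trans)
    moreover have "bar (a # w) \<in> words S"
      using IH g by (simp add: bar_def a words_def)
    ultimately show ?case by simp
  qed
  show ?thesis
  proof (rule groupI)
    fix x y assume "x \<in> carrier ?G" "y \<in> carrier ?G"
    then show "x \<otimes>\<^bsub>?G\<^esub> y \<in> carrier ?G" by (auto simp: car pres_group_mult app)
  next
    show "\<one>\<^bsub>?G\<^esub> \<in> carrier ?G" by (auto simp: car one nil)
  next
    fix x y z assume "x \<in> carrier ?G" "y \<in> carrier ?G" "z \<in> carrier ?G"
    then show "x \<otimes>\<^bsub>?G\<^esub> y \<otimes>\<^bsub>?G\<^esub> z = x \<otimes>\<^bsub>?G\<^esub> (y \<otimes>\<^bsub>?G\<^esub> z)"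
      by (auto simp: car pres_group_mult app)
  next
    fix x assume "x \<in> carrier ?G"
    then show "\<one>\<^bsub>?G\<^esub> \<otimes>\<^bsub>?G\<^esub> x = x" by (auto simp: car one pres_group_mult nil)
  next
    fix x assume "x \<in> carrier ?G"
    then obtain w where w: "w \<in> words S" "x = ?c w" by (auto simp: car)
    show "\<exists>y\<in>carrier ?G. y \<otimes>\<^bsub>?G\<^esub> x = \<one>\<^bsub>?G\<^esub>"
    proof (rule bexI)
      show "?c (bar w) \<otimes>\<^bsub>?G\<^esub> x = \<one>\<^bsub>?G\<^esub>"
        using bar[OF w(1)] w(1) by (simp add: w(2) one pres_group_mult app word_class_eq_iff)
      show "?c (bar w) \<in> carrier ?G" using bar[OF w(1)] by (simp add: car)
    qed
  qed
qed

section \<open>The virtual cactus group\<close>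

datatype vj_gen = GenX nat nat | GenRho nat

definition vj_gens :: "nat \<Rightarrow> vj_gen set"
  where "vj_gens n = {GenX p q | p q. 1 \<le> p \<and> p < q \<and> q \<le> n} \<union> {GenRho i | i. 1 \<le> i \<and> i \<le> n - 1}"

abbreviation xw :: "nat \<Rightarrow> nat \<Rightarrow> vj_gen word" where "xw p q \<equiv> [(GenX p q, True)]"
abbreviation rhow :: "nat \<Rightarrow> vj_gen word" where "rhow i \<equiv> [(GenRho i, True)]"

text \<open>The descending word \<open>rhow q @ rhow (q - 1) @ ... @ rhow p\<close>, for \<open>p \<le> q\<close>.\<close>

definition rho_down :: "nat \<Rightarrow> nat \<Rightarrow> vj_gen word"
  where "rho_down q p = concat (map rhow (rev [p..<Suc q]))"

text \<open>
  A pair \<open>(u, v)\<close> stands for the relation \<open>u = v\<close>. The natural-number subtractions in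
  \<open>j3\<close> and \<open>m1\<close> do not truncate under the side conditions.
\<close>

inductive_set vj_rels :: "nat \<Rightarrow> (vj_gen word \<times> vj_gen word) set"
  for n where
  j1: "1 \<le> p \<Longrightarrow> p < q \<Longrightarrow> q \<le> n \<Longrightarrow> (xw p q @ xw p q, []) \<in> vj_rels n"
| j2: "1 \<le> p \<Longrightarrow> p < q \<Longrightarrow> q \<le> n \<Longrightarrow> 1 \<le> m \<Longrightarrow> m < r \<Longrightarrow> r \<le> n \<Longrightarrow>
    {p..q} \<inter> {m..r} = {} \<Longrightarrow> (xw p q @ xw m r, xw m r @ xw p q) \<in> vj_rels n"
| j3: "1 \<le> p \<Longrightarrow> p < q \<Longrightarrow> q \<le> n \<Longrightarrow> 1 \<le> m \<Longrightarrow> m < r \<Longrightarrow> r \<le> n \<Longrightarrow>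
    {m..r} \<subseteq> {p..q} \<Longrightarrow> (xw p q @ xw m r, xw (p + q - r) (p + q - m) @ xw p q) \<in> vj_rels n"
| s1: "1 \<le> i \<Longrightarrow> i \<le> n - 1 \<Longrightarrow> (rhow i @ rhow i, []) \<in> vj_rels n"
| s2: "1 \<le> i \<Longrightarrow> i \<le> n - 1 \<Longrightarrow> 1 \<le> j \<Longrightarrow> j \<le> n - 1 \<Longrightarrow> \<bar>int i - int j\<bar> = 1 \<Longrightarrow>
    (rhow i @ rhow j @ rhow i, rhow j @ rhow i @ rhow j) \<in> vj_rels n"
| s3: "1 \<le> i \<Longrightarrow> i \<le> n - 1 \<Longrightarrow> 1 \<le> j \<Longrightarrow> j \<le> n - 1 \<Longrightarrow> \<bar>int i - int j\<bar> > 1 \<Longrightarrow>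
    (rhow i @ rhow j, rhow j @ rhow i) \<in> vj_rels n"
| m1: "1 \<le> p \<Longrightarrow> p < q \<Longrightarrow> q \<le> n \<Longrightarrow> 1 \<le> i \<Longrightarrow> i \<le> n - 1 \<Longrightarrow> i < p - 1 \<or> i \<ge> q + 1 \<Longrightarrow>
    (rhow i @ xw p q, xw p q @ rhow i) \<in> vj_rels n"
| m2: "1 \<le> p \<Longrightarrow> p < q \<Longrightarrow> q < n \<Longrightarrow>
    (xw p q @ rho_down q p, rho_down q p @ xw (p + 1) (q + 1)) \<in> vj_rels n"

definition VJ :: "nat \<Rightarrow> vj_gen word set monoid"
  where "VJ n = pres_group (vj_gens n) (vj_rels n)"

definition vj_elem :: "nat \<Rightarrow> vj_gen word \<Rightarrow> vj_gen word set"
  where "vj_elem n = word_class (vj_gens n) (vj_rels n)"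

text \<open>All words occurring in relations use generators in \<open>vj_gens n\<close> only, so that the membership
  conditions in rule \<open>rel\<close> above discard nothing.\<close>

lemma vj_rels_words: "(u, v) \<in> vj_rels n \<Longrightarrow> u \<in> words (vj_gens n) \<and> v \<in> words (vj_gens n)"
  by (induction rule: vj_rels.induct)
     (auto simp: words_def vj_gens_def rho_down_def in_lists_conv_set)

section \<open>Algorithms\<close>

text \<open>
  Algorithms are partial recursive functions: \<open>rec_eval f xs y\<close> says that the computation of
  \<open>f\<close> on the arguments \<open>xs\<close> terminates with result \<open>y\<close>. In \<open>PrimRec\<close> and \<open>Mu\<close> the recursion
  (respectively search) variable comes first.
\<close>

datatype recf = Zero | Succ | Proj nat | Comp recf "recf list" | PrimRec recf recf | Mu recf

inductive rec_eval :: "recf \<Rightarrow> nat list \<Rightarrow> nat \<Rightarrow> bool" where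
  "rec_eval Zero xs 0"
| "rec_eval Succ [a] (Suc a)"
| "i < length xs \<Longrightarrow> rec_eval (Proj i) xs (xs ! i)"
| "list_all2 (\<lambda>g b. rec_eval g xs b) gs bs \<Longrightarrow> rec_eval f bs y \<Longrightarrow> rec_eval (Comp f gs) xs y"
| "rec_eval f xs y \<Longrightarrow> rec_eval (PrimRec f g) (0 # xs) y"
| "rec_eval (PrimRec f g) (k # xs) y \<Longrightarrow> rec_eval g (k # y # xs) z \<Longrightarrow>
    rec_eval (PrimRec f g) (Suc k # xs) z"
| "rec_eval f (k # xs) 0 \<Longrightarrow> \<forall>j<k. \<exists>y. y > 0 \<and> rec_eval f (j # xs) y \<Longrightarrow> rec_eval (Mu f) xs k"

fun gen_code :: "vj_gen \<Rightarrow> nat" where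
  "gen_code (GenX p q) = sum_encode (Inl (prod_encode (p, q)))"
| "gen_code (GenRho i) = sum_encode (Inr i)"

definition word_code :: "vj_gen word \<Rightarrow> nat"
  where "word_code w = list_encode (map (\<lambda>(g, b). prod_encode (gen_code g, of_bool b)) w)"

inductive_cases rec_eval_ZeroE: "rec_eval Zero xs z"
inductive_cases rec_eval_SuccE: "rec_eval Succ xs z"
inductive_cases rec_eval_ProjE: "rec_eval (Proj i) xs z"
inductive_cases rec_eval_CompE: "rec_eval (Comp f gs) xs z"
inductive_cases rec_eval_PrimRec0E: "rec_eval (PrimRec f g) (0 # xs) z"
inductive_cases rec_eval_PrimRecSucE: "rec_eval (PrimRec f g) (Suc k # xs) z"
inductive_cases rec_eval_MuE: "rec_eval (Mu f) xs z"

lemma rec_eval_det: "rec_eval f xs y \<Longrightarrow> rec_eval f xs z \<Longrightarrow> y = z"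
proof (induction arbitrary: z rule: rec_eval.induct)
  case (1 xs)
  from 1(1) show ?case by (rule rec_eval_ZeroE) simp
next
  case (2 a)
  from 2(1) show ?case by (rule rec_eval_SuccE) simp
next
  case (3 i xs)
  from 3(2) show ?case by (rule rec_eval_ProjE) simp
next
  case (4 xs gs bs f y)
  from 4(4) obtain cs where cs: "list_all2 (\<lambda>g b. rec_eval g xs b) gs cs" "rec_eval f cs z"
    by (rule rec_eval_CompE)
  have "bs = cs"
  proof (rule nth_equalityI)
    show len: "length bs = length cs"
      using list_all2_lengthD[OF 4(1)] list_all2_lengthD[OF cs(1)] by simp
    fix i assume "i < length bs"
    then show "bs ! i = cs ! i"
      using list_all2_nthD2[OF 4(1), of i] list_all2_nthD2[OF cs(1), of i] len by simp
  qed
  with cs(2) have "rec_eval f bs z" by simp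
  then show ?case by (rule "4.IH"(2))
next
  case (5 f xs y g)
  from "5.prems" show ?case by (rule rec_eval_PrimRec0E) (rule "5.IH")
next
  case (6 f g k xs y w)
  from "6.prems" obtain v where v: "rec_eval (PrimRec f g) (k # xs) v" "rec_eval g (k # v # xs) z"
    by (rule rec_eval_PrimRecSucE)
  from "6.IH"(1)[OF v(1)] v(2) have "rec_eval g (k # y # xs) z" by simp
  then show ?case by (rule "6.IH"(2))
next
  case (7 f k xs)
  from "7.prems" have z: "rec_eval f (z # xs) 0" "\<forall>j<z. \<exists>y. y > 0 \<and> rec_eval f (j # xs) y"
    using rec_eval_MuE by blast+
  show ?case
  proof (rule linorder_cases[of k z])
    assume "k < z"
    then obtain y where "y > 0" "rec_eval f (k # xs) y" using z(2) by blast
    then show ?thesis using "7.IH"(1)[of y] by simp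
  next
    assume "z < k"
    then obtain y where "y > 0" "\<forall>u. rec_eval f (z # xs) u \<longrightarrow> y = u" using "7.IH"(2) by blast
    then show ?thesis using z(1) by simp
  qed
qed

lemma word_code_inj: "inj word_code"
proof -
  have "inj gen_code"
  proof (rule injI)
    fix g h assume "gen_code g = gen_code h"
    then show "g = h" by (cases g; cases h) (simp_all add: sum_encode_eq)
  qed
  then have "inj (\<lambda>(g, b). prod_encode (gen_code g, of_bool b :: nat))"
    by (auto simp: inj_def)
  then show ?thesis
    unfolding word_code_def by (auto simp: inj_def list_encode_eq dest: map_injective)
qed

end

(* Mapping x_{p,q} to 1 splits VJ_n as a semidirect product of a group K and S_n. The conjugate
   of x_{1,k} by a permutation s depends only on the sequence a = (s(1), ..., s(k)), so K is
   generated by involutions X_a indexed by the sequences a of at least two distinct elements of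
   {1..n}. X_a and X_b commute if a and b are disjoint, and X_a X_b X_a = X_b' if b is a contiguous
   part of a, where b' is the part of a in the mirrored position. Every relation is thus a square
   X_a X_b = X_b' X_a', and three pairwise compatible generators span a cube of such squares. This
   makes X_a act on words that are reduced up to exchanging the sides of squares: bring a to the
   front and cancel it if that is possible, and otherwise prepend it. Together with the action of
   S_n on the letters this gives an action of VJ_n, and a word is trivial if and only if it fixes
   the pair (identity permutation, empty word). The action can be computed letter by letter. *)

theory Submission
  imports Defs "HOL-Library.Sublist" "HOL-Library.Countable" "HOL-Combinatorics.Transposition"
begin

section \<open>Computable functions\<close>

text \<open>Equality up to squares is never decided by the algorithm: \<open>push\<close> returns
  some representative, and triviality is tested at the empty word, which is equal only to itself. A
  letter acts as an involution on reduced words only, so invariance of reducedness comes first. The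
  converse direction needs the X_a inside VJ_n: the conjugate of x_{1,k} must depend on the sequence
  alone, so a rho-word fixing 1, ..., k must equal, by the relations of VJ_n, a word in rho_{k+1},
  ..., rho_{n-1}, which commute with x_{1,k} by (m1). This is a coset enumeration using (s1)-(s3);
  its case k = n says that these relations present S_n. Every relation between the X_a is then a
  conjugate of one relation between intervals. For the algorithm, n is fixed, so letters and
  permutations range over finite sets and are handled by tables; only the recursion over lists of
  letters has to be programmed.\<close>

definition rec1 :: "(nat \<Rightarrow> nat) \<Rightarrow> bool"
  where "rec1 F \<longleftrightarrow> (\<exists>f. \<forall>x. rec_eval f [x] (F x))"

definition rec2 :: "(nat \<Rightarrow> nat \<Rightarrow> nat) \<Rightarrow> bool"
  where "rec2 F \<longleftrightarrow> (\<exists>f. \<forall>x y. rec_eval f [x, y] (F x y))"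

lemma rec_eval_Proj: "i < length xs \<Longrightarrow> y = xs ! i \<Longrightarrow> rec_eval (Proj i) xs y"
  by (simp add: rec_eval.intros)

lemma rec_eval_Comp1: "rec_eval g xs a \<Longrightarrow> rec_eval f [a] y \<Longrightarrow> rec_eval (Comp f [g]) xs y"
  by (rule rec_eval.intros(4)[where bs = "[a]"]) auto

lemma rec_eval_Comp2:
  "rec_eval g xs a \<Longrightarrow> rec_eval h xs b \<Longrightarrow> rec_eval f [a, b] y \<Longrightarrow> rec_eval (Comp f [g, h]) xs y"
  by (rule rec_eval.intros(4)[where bs = "[a, b]"]) auto

lemma rec_eval_Comp3:
  "rec_eval g xs a \<Longrightarrow> rec_eval h xs b \<Longrightarrow> rec_eval k xs c \<Longrightarrow> rec_eval f [a, b, c] y \<Longrightarrow>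
    rec_eval (Comp f [g, h, k]) xs y"
  by (rule rec_eval.intros(4)[where bs = "[a, b, c]"]) auto

lemma rec1_id: "rec1 (\<lambda>x. x)"
  unfolding rec1_def by (rule exI[of _ "Proj 0"]) (auto intro: rec_eval_Proj)

lemma rec1_Suc: "rec1 Suc"
  unfolding rec1_def by (rule exI[of _ Succ]) (auto intro: rec_eval.intros)

lemma rec1_comp: "rec1 F \<Longrightarrow> rec1 G \<Longrightarrow> rec1 (\<lambda>x. F (G x))"
  unfolding rec1_def by (meson rec_eval_Comp1)

lemma rec1_const: "rec1 (\<lambda>x. c)"
proof (induction c)
  case 0
  show ?case unfolding rec1_def by (rule exI[of _ Zero]) (auto intro: rec_eval.intros)
next
  case (Suc c)
  then show ?case by (rule rec1_comp[OF rec1_Suc])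
qed

lemma rec1_comp2: "rec2 F \<Longrightarrow> rec1 G \<Longrightarrow> rec1 H \<Longrightarrow> rec1 (\<lambda>x. F (G x) (H x))"
  unfolding rec1_def rec2_def by (meson rec_eval_Comp2)

lemma rec2_fst: "rec2 (\<lambda>x y. x)"
  unfolding rec2_def by (rule exI[of _ "Proj 0"]) (auto intro: rec_eval_Proj)

lemma rec2_snd: "rec2 (\<lambda>x y. y)"
  unfolding rec2_def by (rule exI[of _ "Proj 1"]) (auto intro: rec_eval_Proj)

lemma rec2_comp1: "rec1 F \<Longrightarrow> rec2 G \<Longrightarrow> rec2 (\<lambda>x y. F (G x y))"
  unfolding rec1_def rec2_def by (meson rec_eval_Comp1)

lemma rec2_comp: "rec2 F \<Longrightarrow> rec2 G \<Longrightarrow> rec2 H \<Longrightarrow> rec2 (\<lambda>x y. F (G x y) (H x y))"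
  unfolding rec2_def by (meson rec_eval_Comp2)

text \<open>Primitive recursion whose step ignores the counter. Addition, subtraction and the runs
  over coded lists are obtained from it.\<close>

lemma rec2_iterate: "rec1 F \<Longrightarrow> rec2 (\<lambda>k x. (F ^^ k) x)"
proof -
  assume "rec1 F"
  then obtain f where f: "\<And>x. rec_eval f [x] (F x)" by (auto simp: rec1_def)
  have "rec_eval (PrimRec (Proj 0) (Comp f [Proj 1])) [k, x] ((F ^^ k) x)" for k x
  proof (induction k)
    case 0
    then show ?case by (auto intro!: rec_eval.intros(5) rec_eval_Proj)
  next
    case (Suc k)
    show ?case
      by (rule rec_eval.intros(6)[OF Suc]) (auto intro!: rec_eval_Comp1 rec_eval_Proj f)
  qed
  then show ?thesis by (auto simp: rec2_def)
qed

lemma rec2_add: "rec2 (+)"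
proof -
  have "(Suc ^^ k) x = k + x" for k x by (induction k) auto
  then show ?thesis using rec2_iterate[OF rec1_Suc] by simp
qed

lemma rec1_primrec:
  assumes "rec2 g"
  shows "rec1 (rec_nat c g)"
proof -
  obtain f where f: "\<And>x y. rec_eval f [x, y] (g x y)" using assms by (auto simp: rec2_def)
  obtain d where d: "\<And>x. rec_eval d [x] c" using rec1_const by (auto simp: rec1_def)
  \<comment> \<open>The parameter \<open>x\<close> is a dummy that makes the base case unary, so
    that \<open>rec1_const\<close> supplies it; at the end it is identified with the
    counter.\<close>
  have "rec_eval (PrimRec d (Comp f [Proj 0, Proj 1])) [k, x] (rec_nat c g k)" for k x
  proof (induction k)
    case 0
    then show ?case by (auto intro!: rec_eval.intros(5) d)
  next
    case (Suc k)
    show ?case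
      by (rule rec_eval.intros(6)[OF Suc]) (auto intro!: rec_eval_Comp2 rec_eval_Proj f)
  qed
  then have "rec2 (\<lambda>k x. rec_nat c g k)" by (auto simp: rec2_def)
  from rec1_comp2[OF this rec1_id rec1_id] show ?thesis by simp
qed

lemma rec1_pred: "rec1 (\<lambda>x. x - 1)"
proof -
  have "rec_nat 0 (\<lambda>x y. x) k = k - 1" for k by (cases k) auto
  then show ?thesis using rec1_primrec[OF rec2_fst, of 0] by presburger
qed

lemma rec2_diff: "rec2 (-)"
proof -
  have "((\<lambda>x. x - 1) ^^ k) x = x - k" for k x :: nat by (induction k) auto
  then have "rec2 (\<lambda>k x. x - k)" using rec2_iterate[OF rec1_pred] by simp
  from rec2_comp[OF this rec2_snd rec2_fst] show ?thesis .
qed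

lemma rec1_triangle: "rec1 triangle"
proof -
  have "rec_nat 0 (\<lambda>x y. y + Suc x) = triangle"
  proof
    show "rec_nat 0 (\<lambda>x y. y + Suc x) k = triangle k" for k by (induction k) auto
  qed
  moreover have "rec2 (\<lambda>x y. y + Suc x)"
    by (intro rec2_comp[OF rec2_add] rec2_snd rec2_comp1[OF rec1_Suc] rec2_fst)
  ultimately show ?thesis using rec1_primrec[of "\<lambda>x y. y + Suc x" 0] by metis
qed

lemma rec1_prod_encode:
  assumes "rec1 F" "rec1 G"
  shows "rec1 (\<lambda>x. prod_encode (F x, G x))"
proof -
  have "rec2 (\<lambda>x y. triangle (x + y) + x)"
    by (intro rec2_comp[OF rec2_add] rec2_fst rec2_comp1[OF rec1_triangle] rec2_snd)
  from rec1_comp2[OF this assms] show ?thesis by (simp add: prod_encode_def)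
qed

lemma strict_mono_triangle: "strict_mono triangle"
  by (simp add: strict_mono_Suc_iff)

text \<open>The sum of the two components of \<open>z\<close> is found by unbounded search for the row of
  Cantor's triangle that contains \<open>z\<close>.\<close>

lemma rec1_prod_decode_sum: "rec1 (\<lambda>z. fst (prod_decode z) + snd (prod_decode z))"
proof -
  \<comment> \<open>The truncated difference is 0 exactly if \<open>z < triangle (Suc s)\<close>,
    and the least such \<open>s\<close> is the row of \<open>z\<close>.\<close>
  have "rec2 (\<lambda>s z. Suc z - triangle (Suc s))"
    by (intro rec2_comp[OF rec2_diff] rec2_comp1[OF rec1_Suc] rec2_comp1[OF rec1_triangle]
        rec2_fst rec2_snd)
  then obtain f where f: "\<And>s z. rec_eval f [s, z] (Suc z - triangle (Suc s))"
    by (auto simp: rec2_def)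
  have "rec_eval (Mu f) [z] (fst (prod_decode z) + snd (prod_decode z))" for z
  proof -
    obtain a b where ab: "prod_decode z = (a, b)" by force
    have "z = prod_encode (a, b)" using prod_decode_inverse[of z] ab by simp
    then have z: "z = triangle (a + b) + a" by (simp add: prod_encode_def)
    have "rec_eval (Mu f) [z] (a + b)"
    proof (rule rec_eval.intros(7))
      show "rec_eval f [a + b, z] 0" using f[of "a + b" z] by (simp add: z)
      show "\<forall>j<a + b. \<exists>y>0. rec_eval f [j, z] y"
      proof (intro allI impI)
        fix j assume "j < a + b"
        then have "triangle (Suc j) \<le> triangle (a + b)"
          using strict_mono_triangle by (simp add: strict_mono_less_eq del: triangle_Suc)
        then have "Suc z - triangle (Suc j) > 0" by (simp add: z)
        then show "\<exists>y>0. rec_eval f [j, z] y" using f by blast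
      qed
    qed
    then show ?thesis by (simp add: ab)
  qed
  then show ?thesis by (auto simp: rec1_def)
qed

lemma rec1_fst_decode: "rec1 (\<lambda>z. fst (prod_decode z))"
proof -
  have "fst (prod_decode z) = z - triangle (fst (prod_decode z) + snd (prod_decode z))" for z
    using prod_decode_inverse[of z] by (cases "prod_decode z") (auto simp: prod_encode_def)
  moreover have "rec1 (\<lambda>z. z - triangle (fst (prod_decode z) + snd (prod_decode z)))"
    by (intro rec1_comp2[OF rec2_diff] rec1_id rec1_comp[OF rec1_triangle] rec1_prod_decode_sum)
  ultimately show ?thesis by presburger
qed

lemma rec1_snd_decode: "rec1 (\<lambda>z. snd (prod_decode z))"
proof -
  have "snd (prod_decode z) =
      (fst (prod_decode z) + snd (prod_decode z)) - fst (prod_decode z)" for z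
    by simp
  moreover have "rec1 (\<lambda>z. (fst (prod_decode z) + snd (prod_decode z)) - fst (prod_decode z))"
    by (intro rec1_comp2[OF rec2_diff] rec1_fst_decode rec1_prod_decode_sum)
  ultimately show ?thesis by presburger
qed

lemma rec1_if_zero:
  assumes "rec1 P" "rec1 F" "rec1 G"
  shows "rec1 (\<lambda>x. if P x = 0 then F x else G x)"
proof -
  obtain p f g where pfg: "\<And>x. rec_eval p [x] (P x)" "\<And>x. rec_eval f [x] (F x)"
    "\<And>x. rec_eval g [x] (G x)"
    using assms by (auto simp: rec1_def)
  \<comment> \<open>The step function receives \<open>[k, y, a, b]\<close>, so \<open>Proj 3\<close>
    returns \<open>b\<close> whatever the previous value was.\<close>
  have c: "rec_eval (PrimRec (Proj 0) (Proj 3)) [k, a, b] (if k = 0 then a else b)" for k a b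
  proof (induction k)
    case 0
    then show ?case by (auto intro!: rec_eval.intros(5) rec_eval_Proj)
  next
    case (Suc k)
    show ?case by (rule rec_eval.intros(6)[OF Suc]) (auto intro!: rec_eval_Proj)
  qed
  have "rec_eval (Comp (PrimRec (Proj 0) (Proj 3)) [p, f, g]) [x]
      (if P x = 0 then F x else G x)" for x
    by (rule rec_eval_Comp3[OF pfg c])
  then show ?thesis unfolding rec1_def by blast
qed

lemma rec1_if_eq:
  assumes "rec1 P" "rec1 Q" "rec1 F" "rec1 G"
  shows "rec1 (\<lambda>x. if P x = Q x then F x else G x)"
proof -
  have "(a = b) = ((a - b) + (b - a) = (0::nat))" for a b by auto
  moreover have "rec1 (\<lambda>x. if (P x - Q x) + (Q x - P x) = 0 then F x else G x)"
    by (intro rec1_if_zero assms rec1_comp2[OF rec2_add] rec1_comp2[OF rec2_diff])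
  ultimately show ?thesis by presburger
qed

section \<open>Computability through encodings\<close>

text \<open>\<open>h\<close> realizes \<open>F\<close> on codes and is constrained only on the codes
  of \<open>D\<close>. This relativization lets a finite table realize a function whose values
  outside \<open>D\<close> are irrelevant.\<close>

definition comp_on :: "'a set \<Rightarrow> ('a \<Rightarrow> nat) \<Rightarrow> ('b \<Rightarrow> nat) \<Rightarrow> ('a \<Rightarrow> 'b) \<Rightarrow> bool"
  where "comp_on D e e' F \<longleftrightarrow> (\<exists>h. rec1 h \<and> (\<forall>x\<in>D. h (e x) = e' (F x)))"

definition pair_enc :: "('a \<Rightarrow> nat) \<Rightarrow> ('b \<Rightarrow> nat) \<Rightarrow> 'a \<times> 'b \<Rightarrow> nat"
  where "pair_enc e e' p = prod_encode (e (fst p), e' (snd p))"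

definition list_enc :: "('a \<Rightarrow> nat) \<Rightarrow> 'a list \<Rightarrow> nat"
  where "list_enc e xs = list_encode (map e xs)"

lemma comp_on_id: "comp_on D e e (\<lambda>x. x)"
  unfolding comp_on_def using rec1_id by blast

lemma comp_on_const: "comp_on D e e' (\<lambda>x. c)"
  unfolding comp_on_def using rec1_const[of "e' c"] by auto

lemma comp_on_comp:
  assumes "comp_on D' e' e'' G" "comp_on D e e' F" "\<And>x. x \<in> D \<Longrightarrow> F x \<in> D'"
  shows "comp_on D e e'' (\<lambda>x. G (F x))"
proof -
  obtain h k where "rec1 h" "\<forall>x\<in>D. h (e x) = e' (F x)" "rec1 k" "\<forall>x\<in>D'. k (e' x) = e'' (G x)"
    using assms(1,2) by (auto simp: comp_on_def)
  then show ?thesis unfolding comp_on_def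
    by (intro exI[of _ "\<lambda>x. k (h x)"]) (auto simp: rec1_comp assms(3))
qed

lemma comp_on_pair:
  assumes "comp_on D e e1 F" "comp_on D e e2 G"
  shows "comp_on D e (pair_enc e1 e2) (\<lambda>x. (F x, G x))"
proof -
  obtain h k where "rec1 h" "\<forall>x\<in>D. h (e x) = e1 (F x)" "rec1 k" "\<forall>x\<in>D. k (e x) = e2 (G x)"
    using assms by (auto simp: comp_on_def)
  then show ?thesis unfolding comp_on_def
    by (intro exI[of _ "\<lambda>x. prod_encode (h x, k x)"]) (auto simp: rec1_prod_encode pair_enc_def)
qed

lemma comp_on_fst: "comp_on D (pair_enc e e') e fst"
  unfolding comp_on_def
  by (rule exI[of _ "\<lambda>z. fst (prod_decode z)"]) (simp add: rec1_fst_decode pair_enc_def)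

lemma comp_on_snd: "comp_on D (pair_enc e e') e' snd"
  unfolding comp_on_def
  by (rule exI[of _ "\<lambda>z. snd (prod_decode z)"]) (simp add: rec1_snd_decode pair_enc_def)

lemma comp_on_Cons: "comp_on D (pair_enc e (list_enc e)) (list_enc e) (\<lambda>p. fst p # snd p)"
proof -
  have "Suc (pair_enc e (list_enc e) p) = list_enc e (fst p # snd p)" for p
    unfolding pair_enc_def list_enc_def by (simp only: list.map list_encode.simps fst_conv snd_conv)
  then show ?thesis unfolding comp_on_def using rec1_Suc by blast
qed

lemma comp_on_if_eq:
  assumes "comp_on D e e1 P" "comp_on D e e1 Q" "inj_on e1 (P ` D \<union> Q ` D)"
    and "comp_on D e e2 F" "comp_on D e e2 G"
  shows "comp_on D e e2 (\<lambda>x. if P x = Q x then F x else G x)"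
proof -
  obtain p where p: "rec1 p" "\<forall>x\<in>D. p (e x) = e1 (P x)"
    using assms(1) unfolding comp_on_def by blast
  obtain q where q: "rec1 q" "\<forall>x\<in>D. q (e x) = e1 (Q x)"
    using assms(2) unfolding comp_on_def by blast
  obtain f where f: "rec1 f" "\<forall>x\<in>D. f (e x) = e2 (F x)"
    using assms(4) unfolding comp_on_def by blast
  obtain g where g: "rec1 g" "\<forall>x\<in>D. g (e x) = e2 (G x)"
    using assms(5) unfolding comp_on_def by blast
  have "e1 (P x) = e1 (Q x) \<longleftrightarrow> P x = Q x" if "x \<in> D" for x
    using inj_on_eq_iff[OF assms(3), of "P x" "Q x"] that by blast
  then have "\<forall>x\<in>D. (if p (e x) = q (e x) then f (e x) else g (e x)) =
      e2 (if P x = Q x then F x else G x)"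
    using p(2) q(2) f(2) g(2) by simp
  then show ?thesis unfolding comp_on_def
    using rec1_if_eq[OF p(1) q(1) f(1) g(1)] by blast
qed

text \<open>A table is built one entry at a time, comparing the code of the second component with
  \<open>e2 b\<close>. Its entries are programs for the slices of \<open>F\<close>, so the first
  component may range over an infinite set.\<close>

lemma comp_on_finite_snd:
  assumes "finite B" "inj_on e2 B" "\<And>b. b \<in> B \<Longrightarrow> comp_on D e1 e (\<lambda>x. F (x, b))"
  shows "comp_on (D \<times> B) (pair_enc e1 e2) e F"
  using assms
proof (induction B rule: finite_induct)
  case empty
  then show ?case by (auto simp: comp_on_def intro: rec1_id)
next
  case (insert b B)
  then obtain h where h: "rec1 h" "\<forall>x\<in>D \<times> B. h (pair_enc e1 e2 x) = e (F x)"
    by (auto simp: comp_on_def)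
  obtain k where k: "rec1 k" "\<forall>x\<in>D. k (e1 x) = e (F (x, b))"
    using insert.prems(2)[of b] by (auto simp: comp_on_def)
  let ?h = "\<lambda>z. if snd (prod_decode z) = e2 b then k (fst (prod_decode z)) else h z"
  have "rec1 ?h"
    by (intro rec1_if_eq rec1_snd_decode rec1_const rec1_comp[OF k(1)] rec1_fst_decode h(1))
  moreover have "e2 c \<noteq> e2 b" if "c \<in> B" for c
    using insert.prems(1) insert.hyps that by (auto simp: inj_on_def)
  then have "?h (pair_enc e1 e2 x) = e (F x)" if "x \<in> D \<times> insert b B" for x
    using that h(2) k(2) by (auto simp: pair_enc_def)
  ultimately show ?case unfolding comp_on_def by blast
qed

lemma comp_on_finite:
  assumes "finite D" "inj_on e D"
  shows "comp_on D e e' F"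
proof -
  have "comp_on ({()} \<times> D) (pair_enc (\<lambda>_. 0) e) e' (\<lambda>x. F (snd x))"
    by (rule comp_on_finite_snd[OF assms]) (auto intro: comp_on_const)
  moreover have "comp_on D e (pair_enc (\<lambda>_. 0) e) (\<lambda>x. ((), x))"
    by (intro comp_on_pair comp_on_const comp_on_id)
  ultimately have "comp_on D e e' (\<lambda>x. F (snd ((), x)))" by (rule comp_on_comp) auto
  then show ?thesis by simp
qed

lemma length_le_list_encode: "length xs \<le> list_encode xs"
proof (induction xs)
  case (Cons x xs)
  then show ?case using le_prod_encode_2[of "list_encode xs" x] by simp
qed simp

text \<open>A loop whose body consumes one list cell. The code of the list bounds its length and
  serves as the number of rounds; surplus rounds are harmless because the body fixes every pair with
  an empty list.\<close>

lemma comp_on_fold: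
  assumes step: "comp_on (S \<times> A) (pair_enc e1 e2) e1 (\<lambda>p. f (snd p) (fst p))"
    and closed: "\<And>a s. a \<in> A \<Longrightarrow> s \<in> S \<Longrightarrow> f a s \<in> S"
  shows "comp_on (S \<times> lists A) (pair_enc e1 (list_enc e2)) e1 (\<lambda>p. fold f (snd p) (fst p))"
proof -
  obtain h where h: "rec1 h" "\<forall>p\<in>S \<times> A. h (pair_enc e1 e2 p) = e1 (f (snd p) (fst p))"
    using step by (auto simp: comp_on_def)
  \<comment> \<open>Code 0 is the empty list; otherwise subtracting 1 undoes the \<open>Suc\<close>
    in \<open>list_encode\<close> and leaves the pair of head and tail.\<close>
  define L where "L z = (if snd (prod_decode z) = 0 then z else
    prod_encode (h (prod_encode (fst (prod_decode z), fst (prod_decode (snd (prod_decode z) - 1)))),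
      snd (prod_decode (snd (prod_decode z) - 1))))" for z
  have L: "rec1 L"
    unfolding L_def
    by (intro rec1_if_zero rec1_id rec1_prod_encode rec1_comp[OF h(1)] rec1_snd_decode
        rec1_fst_decode rec1_comp[OF rec1_fst_decode] rec1_comp[OF rec1_snd_decode]
        rec1_comp[OF rec1_pred])
  have run: "(L ^^ k) (prod_encode (e1 s, list_enc e2 xs)) = prod_encode (e1 (fold f xs s), 0)"
    if "s \<in> S" "xs \<in> lists A" "length xs \<le> k" for s xs k
    using that
  proof (induction k arbitrary: s xs)
    case 0
    then show ?case by (simp add: list_enc_def)
  next
    case (Suc k)
    show ?case
    proof (cases xs)
      case Nil
      have "L (prod_encode (e1 s, 0)) = prod_encode (e1 s, 0)" by (simp add: L_def)
      then show ?thesis using Suc.IH[of s "[]"] Suc.prems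
        by (simp add: Nil list_enc_def funpow_Suc_right del: funpow.simps)
    next
      case (Cons a ys)
      have "h (prod_encode (e1 s, e2 a)) = e1 (f a s)"
        using h(2) Suc.prems Cons by (force simp: pair_enc_def)
      then have "L (prod_encode (e1 s, list_enc e2 xs)) = prod_encode (e1 (f a s), list_enc e2 ys)"
        by (simp add: L_def list_enc_def Cons)
      then show ?thesis using Suc.IH[of "f a s" ys] Suc.prems closed
        by (simp add: Cons funpow_Suc_right del: funpow.simps)
    qed
  qed
  let ?h = "\<lambda>z. fst (prod_decode ((L ^^ snd (prod_decode z)) z))"
  have "rec1 ?h"
    by (intro rec1_comp[OF rec1_fst_decode] rec1_comp2[OF rec2_iterate[OF L]] rec1_snd_decode
        rec1_id)
  moreover have "?h (pair_enc e1 (list_enc e2) p) = e1 (fold f (snd p) (fst p))"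
    if "p \<in> S \<times> lists A" for p
  proof -
    have "length (snd p) \<le> list_enc e2 (snd p)"
      using length_le_list_encode[of "map e2 (snd p)"] by (simp add: list_enc_def)
    moreover have "fst p \<in> S" "snd p \<in> lists A" using that by auto
    ultimately show ?thesis using run[of "fst p" "snd p"] by (simp add: pair_enc_def)
  qed
  ultimately show ?thesis unfolding comp_on_def by blast
qed

lemma comp_on_rev: "comp_on (lists A) (list_enc e) (list_enc e) rev"
proof -
  have "comp_on (UNIV \<times> A) (pair_enc (list_enc e) e) (list_enc e) (\<lambda>p. snd p # fst p)"
  proof -
    have "comp_on (UNIV \<times> A) (pair_enc (list_enc e) e) (list_enc e)
        (\<lambda>p. fst (snd p, fst p) # snd (snd p, fst p))"
      by (rule comp_on_comp[OF comp_on_Cons[of UNIV]])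
        (auto intro: comp_on_pair comp_on_fst comp_on_snd)
    then show ?thesis by simp
  qed
  from comp_on_fold[OF this]
  have "comp_on (UNIV \<times> lists A) (pair_enc (list_enc e) (list_enc e)) (list_enc e)
      (\<lambda>p. fold Cons (snd p) (fst p))"
    by simp
  moreover have "comp_on (lists A) (list_enc e) (pair_enc (list_enc e) (list_enc e)) (\<lambda>x. ([], x))"
    by (intro comp_on_pair comp_on_const comp_on_id)
  ultimately have "comp_on (lists A) (list_enc e) (list_enc e) rev"
    using comp_on_comp[where F = "\<lambda>x. ([], x)"] by (fastforce simp: fold_Cons_rev)
  then show ?thesis .
qed

section \<open>Groups of involutions with square relations\<close>

text \<open>
  The generators are involutions, and a compatible pair \<open>C a b\<close> spans a square
  \<open>a \<cdot> \<phi> a b = b \<cdot> \<phi> b a\<close>. The last axiom closes the cube spanned by three compatible generators.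
\<close>

locale square_system =
  fixes C :: "'a \<Rightarrow> 'a \<Rightarrow> bool" and \<phi> :: "'a \<Rightarrow> 'a \<Rightarrow> 'a"
  assumes C_irrefl: "\<not> C a a"
    and C_sym: "C a b \<Longrightarrow> C b a"
    and C_\<phi>: "C a b \<Longrightarrow> C a (\<phi> a b)"
    and \<phi>_\<phi>: "C a b \<Longrightarrow> \<phi> a (\<phi> a b) = b"
    and \<phi>_opposite: "C a b \<Longrightarrow> \<phi> (\<phi> a b) a = \<phi> b a"
    and C_\<phi>_\<phi>: "C a b \<Longrightarrow> C a c \<Longrightarrow> C b c \<Longrightarrow> C (\<phi> a b) (\<phi> a c)"
    and cube: "C a b \<Longrightarrow> C a c \<Longrightarrow> C b c \<Longrightarrow> \<phi> (\<phi> a b) (\<phi> a c) = \<phi> (\<phi> b a) (\<phi> b c)"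
begin

text \<open>
  Equality of words in the monoid with the square relations. The third rule is a consequence of
  these relations; taking it as the definition makes the inversion rule say that
  \<open>a # u\<close> and \<open>b # v\<close> can only be equal by completing the square spanned by \<open>a\<close> and \<open>b\<close>.
\<close>

inductive sw :: "'a list \<Rightarrow> 'a list \<Rightarrow> bool" where
  Nil: "sw [] []"
| Cons: "sw u v \<Longrightarrow> sw (a # u) (a # v)"
| square: "C a b \<Longrightarrow> sw u (\<phi> a b # z) \<Longrightarrow> sw v (\<phi> b a # z) \<Longrightarrow> sw (a # u) (b # v)"

inductive_cases sw_ConsConsE: "sw (a # u) (b # v)"
lemmas sw_cases = sw_ConsConsE[consumes 1, case_names same square]

lemma sw_refl: "sw w w"
  by (induction w) (auto intro: sw.intros)

lemma sw_sym: "sw u v \<Longrightarrow> sw v u"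
  by (induction rule: sw.induct) (auto intro: sw.intros C_sym)

lemma sw_length: "sw u v \<Longrightarrow> length u = length v"
  by (induction rule: sw.induct) auto

lemma sw_Nil_iff: "sw [] v \<longleftrightarrow> v = []" "sw v [] \<longleftrightarrow> v = []"
  using sw_length sw_refl by fastforce+

lemma C_opposite: "C a b \<Longrightarrow> C (\<phi> a b) (\<phi> b a)"
  using C_\<phi>[of "\<phi> a b" a] C_\<phi>[of a b] C_sym[of a "\<phi> a b"] \<phi>_opposite[of a b] by metis

lemma \<phi>_opposite_opposite: "C a b \<Longrightarrow> \<phi> (\<phi> a b) (\<phi> b a) = a"
  by (metis C_\<phi> C_sym \<phi>_\<phi> \<phi>_opposite)

lemma \<phi>_neq: "C a b \<Longrightarrow> \<phi> a b \<noteq> a"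
  using C_\<phi> C_irrefl by metis

lemma \<phi>_inj: "C a b \<Longrightarrow> C a c \<Longrightarrow> \<phi> a b = \<phi> a c \<Longrightarrow> b = c"
  by (metis \<phi>_\<phi>)

text \<open>\<open>\<phi> a\<close> is an involution on the letters compatible with
  \<open>a\<close>, so the axiom \<open>C_\<phi>_\<phi>\<close> can be reversed.\<close>

lemma C_\<phi>_\<phi>_iff: "C a b \<Longrightarrow> C a c \<Longrightarrow> C (\<phi> a b) (\<phi> a c) \<Longrightarrow> C b c"
  by (metis C_\<phi>_\<phi> C_\<phi> \<phi>_\<phi>)

lemma sw_square: "C a b \<Longrightarrow> sw (a # \<phi> a b # z) (b # \<phi> b a # z)"
  by (rule square[OF _ sw_refl sw_refl])

text \<open>The rule \<open>square\<close> exchanges the sides of one square at the head, so two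
  consecutive squares \<open>a, b\<close> and \<open>b, c\<close> have to be merged into one. The
  induction hypothesis compares the two descriptions of the middle tail: either both squares
  coincide, or \<open>a\<close>, \<open>b\<close>, \<open>c\<close> span a cube whose face on
  \<open>a\<close> and \<open>c\<close> is the required square. Induction on the length allows tails
  to be replaced by equal words.\<close>

lemma sw_trans: "sw u v \<Longrightarrow> sw v w \<Longrightarrow> sw u w"
proof (induction "length u" arbitrary: u v w rule: less_induct)
  case less
  show ?case
  proof (cases u)
    case Nil
    then show ?thesis using less.prems by (simp add: sw_Nil_iff)
  next
    case (Cons a u')
    then obtain b v' where v: "v = b # v'" using sw_length[OF less.prems(1)] by (cases v) auto
    then obtain c w' where w: "w = c # w'" using sw_length[OF less.prems(2)] by (cases w) auto
    have IH: "sw r t" if "sw r s" "sw s t" "length r < length u" for r s t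
      using less.hyps[of r s t] that by blast
    have len: "length u' < length u" "length v' < length u" "length w' < length u"
      using sw_length[OF less.prems(1)] sw_length[OF less.prems(2)] by (simp_all add: Cons v w)
    have sq: "sw (x # s) (y # t)"
      if "C x y" "sw s (\<phi> x y # r)" "sw t (\<phi> y x # r)" for x y s t r
      using that by (rule square)
    from less.prems(1)[unfolded Cons v] show ?thesis
    proof (cases rule: sw_cases)
      case ab: same
      from less.prems(2)[unfolded v w] show ?thesis
      proof (cases rule: sw_cases)
        case 1: same
        then show ?thesis using ab IH[of u' v' w'] len unfolding Cons w by (auto intro: sw.Cons)
      next
        case 2: (square z)
        then show ?thesis using ab IH[of u' v'] len unfolding Cons w by (auto intro: square)
      qed
    next
      case ab: (square y)
      from less.prems(2)[unfolded v w] show ?thesis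
      proof (cases rule: sw_cases)
        case 1: same
        have "sw w' (\<phi> b a # y)" using IH[of w' v'] 1 ab len by (blast intro: sw_sym)
        then show ?thesis using ab 1 unfolding Cons w by (auto intro: square)
      next
        case bc: (square z)
        have "sw (\<phi> b a # y) (\<phi> b c # z)"
          using IH[of "\<phi> b a # y" v'] bc ab(3) len sw_length[OF ab(3)] by (simp add: sw_sym)
        then show ?thesis
        proof (cases rule: sw_cases)
          case 1: same
          \<comment> \<open>The two squares share two sides and hence coincide.\<close>
          then have "a = c" using \<phi>_inj[OF C_sym[OF ab(1)] bc(1)] 1(1) by simp
          have "sw (\<phi> a b # y) (\<phi> c b # z)" using 1 \<open>a = c\<close> by (auto intro: sw.Cons)
          then have "sw u' w'"
            using IH[of u' "\<phi> a b # y" "\<phi> c b # z"] IH[of u' "\<phi> c b # z" w'] ab bc len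
            by (blast intro: sw_sym)
          then show ?thesis unfolding Cons w \<open>a = c\<close> by (rule sw.Cons)
        next
          case 2: (square t)
          note C = \<open>C a b\<close> C_sym[OF \<open>C a b\<close>] \<open>C b c\<close> C_sym[OF \<open>C b c\<close>]
          have ac: "C a c" using C_\<phi>_\<phi>_iff[of b a c] C 2 by blast
          note ca = C_sym[OF ac]
          \<comment> \<open>\<open>d\<close>, \<open>e\<close> and \<open>f\<close> are the edges of
            the cube that end in the vertex opposite to its origin. Each lies on two faces, and
            \<open>cube\<close> says that both faces give the same label.\<close>
          define d where "d = \<phi> (\<phi> a b) (\<phi> a c)"
          define e where "e = \<phi> (\<phi> c b) (\<phi> c a)"
          define f where "f = \<phi> (\<phi> a c) (\<phi> a b)"
          have d: "\<phi> (\<phi> b a) (\<phi> b c) = d" using cube[of a b c] C ac by (simp add: d_def)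
          have e: "\<phi> (\<phi> b c) (\<phi> b a) = e" using cube[of b c a] C ca by (simp add: e_def)
          have f: "\<phi> (\<phi> c a) (\<phi> c b) = f" using cube[of a c b] C ac by (simp add: f_def)
          have ly: "length y < length u'" using sw_length[OF ab(2)] by simp
          have lz: "Suc (length z) = length w'" using sw_length[OF bc(3)] by simp
          have "sw u' (\<phi> a b # d # t)"
            by (rule IH[OF ab(2)]) (use 2 d len in \<open>auto intro: sw.Cons\<close>)
          moreover have "sw (\<phi> a b # d # t) (\<phi> a c # f # t)"
            unfolding d_def f_def using C_\<phi>_\<phi>[of a b c] C ac by (simp add: sw_square)
          ultimately have 3: "sw u' (\<phi> a c # f # t)" using IH len by blast
          have "sw w' (\<phi> c b # e # t)"
            by (rule IH[OF bc(3)]) (use 2 e len in \<open>auto intro: sw.Cons\<close>)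
          moreover have "sw (\<phi> c b # e # t) (\<phi> c a # f # t)"
            unfolding e_def f[symmetric] using C_\<phi>_\<phi>[of c b a] C ca C_sym[OF C(1)]
            by (simp add: sw_square)
          ultimately have 4: "sw w' (\<phi> c a # f # t)" using IH len by blast
          show ?thesis unfolding Cons w using ac 3 4 by (rule square)
        qed
      qed
    qed
  qed
qed

section \<open>Bringing a letter to the front, and the action of a letter on words\<close>

lemma sw_Cons_iff: "sw (a # u) (a # v) \<longleftrightarrow> sw u v"
  by (auto intro: sw.Cons elim: sw_ConsConsE dest: C_irrefl[THEN notE])

lemma sw_Cons_neqE:
  assumes "sw (a # u) (b # v)" "a \<noteq> b"
  obtains z where "C a b" "sw u (\<phi> a b # z)" "sw v (\<phi> b a # z)"
  using assms by (auto elim: sw_ConsConsE)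

text \<open>Tests without backtracking whether \<open>a\<close> can be brought to the front. If
  \<open>b # v\<close> equals a word beginning with \<open>a \<noteq> b\<close>, then inversion of
  \<open>sw\<close> forces \<open>v\<close> to begin with \<open>\<phi> b a\<close> up to squares.
  So the letter sought changes along each square it crosses, and \<open>\<phi> a b\<close> is left
  behind.\<close>

fun strip :: "'a \<Rightarrow> 'a list \<Rightarrow> 'a list option" where
  "strip a [] = None"
| "strip a (b # v) = (if a = b then Some v
    else if C a b then map_option ((#) (\<phi> a b)) (strip (\<phi> b a) v) else None)"

lemma strip_Some: "strip a w = Some v \<Longrightarrow> sw w (a # v)"
proof (induction w arbitrary: a v)
  case (Cons b w)
  then show ?case
    by (auto split: if_splits intro: sw_refl sw.Cons)
       (metis C_sym Cons.IH sw_refl square)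
qed simp

lemma strip_None: "strip a w = None \<Longrightarrow> \<not> sw w (a # v)"
proof (induction w arbitrary: a v)
  case Nil
  then show ?case by (simp add: sw_Nil_iff)
next
  case (Cons b w)
  show ?case
  proof
    assume sw: "sw (b # w) (a # v)"
    have "a \<noteq> b" using Cons.prems by auto
    with sw obtain z where "C b a" "sw w (\<phi> b a # z)" by (metis sw_Cons_neqE)
    then show False using Cons \<open>a \<noteq> b\<close> by (auto dest: C_sym)
  qed
qed

definition push :: "'a \<Rightarrow> 'a list \<Rightarrow> 'a list"
  where "push a w = (case strip a w of None \<Rightarrow> a # w | Some v \<Rightarrow> v)"

definition starts :: "'a \<Rightarrow> 'a list \<Rightarrow> bool"
  where "starts a w \<longleftrightarrow> (\<exists>v. sw w (a # v))"

lemma starts_cong: "sw u v \<Longrightarrow> starts a u \<longleftrightarrow> starts a v"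
  unfolding starts_def by (blast intro: sw_trans sw_sym)

lemma push_cases:
  obtains "sw w (a # push a w)" | "\<not> starts a w" "push a w = a # w"
  by (cases "strip a w") (auto simp: push_def starts_def dest: strip_Some strip_None)

lemma push_starts: "sw w (a # v) \<Longrightarrow> sw (push a w) v"
  by (rule push_cases[of w a]) (auto simp: starts_def dest: sw_sym intro: sw_trans sw_Cons_iff[THEN iffD1])

lemma push_not_starts: "\<not> starts a w \<Longrightarrow> push a w = a # w"
  by (rule push_cases[of w a]) (auto simp: starts_def)

lemma push_cong: "sw u v \<Longrightarrow> sw (push a u) (push a v)"
proof (cases "starts a u")
  case True
  assume uv: "sw u v"
  from True obtain u' where "sw u (a # u')" by (auto simp: starts_def)
  moreover from this have "sw v (a # u')" using uv by (blast intro: sw_sym sw_trans)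
  ultimately show ?thesis using push_starts by (blast intro: sw_sym sw_trans)
next
  case False
  assume uv: "sw u v"
  with False have "\<not> starts a v" by (simp add: starts_cong)
  with False uv show ?thesis by (simp add: push_not_starts sw_Cons_iff)
qed

text \<open>Here \<open>push p\<close> prepends. If \<open>r\<close> is prepended as well, nothing
  cancels and the results are the two sides of one square. If \<open>r\<close> cancels, then
  \<open>\<phi> p r\<close> cancels on the left-hand side, because \<open>p\<close> followed by
  \<open>r\<close> can be exchanged for \<open>\<phi> p r\<close> followed by
  \<open>\<phi> r p\<close>.\<close>

lemma push_square_not_starts:
  assumes "C p r" "\<not> starts p w"
  shows "sw (push (\<phi> p r) (push p w)) (push (\<phi> r p) (push r w))"
proof -
  let ?P = "\<phi> r p" and ?R = "\<phi> p r"
  have C': "C r p" "C ?R ?P" "C ?P ?R" "C p ?R" "C r ?P"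
    using assms C_opposite C_sym C_\<phi> by blast+
  have opp: "\<phi> ?R ?P = p" "\<phi> ?P ?R = r" "\<phi> p ?R = r" "\<phi> r ?P = p" "\<phi> ?R p = ?P" "\<phi> ?P r = ?R"
    using assms(1) C' \<phi>_opposite_opposite \<phi>_\<phi> \<phi>_opposite by blast+
  have p: "push p w = p # w" by (rule push_not_starts[OF assms(2)])
  show ?thesis
  proof (cases "starts r w")
    case False
    \<comment> \<open>By inversion, \<open>w\<close> would otherwise begin with
      \<open>\<phi> p ?R\<close>, which is \<open>r\<close>.\<close>
    have 1: "\<not> starts ?R (p # w)"
    proof
      assume "starts ?R (p # w)"
      then obtain t where "sw (p # w) (?R # t)" by (auto simp: starts_def)
      then obtain z where "sw w (\<phi> p ?R # z)"
        using C_irrefl C' by (metis sw_Cons_neqE)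
      with False show False by (auto simp: starts_def opp)
    qed
    have 2: "\<not> starts ?P (r # w)"
    proof
      assume "starts ?P (r # w)"
      then obtain t where "sw (r # w) (?P # t)" by (auto simp: starts_def)
      then obtain z where "sw w (\<phi> r ?P # z)"
        using C_irrefl C' by (metis sw_Cons_neqE)
      with assms(2) show False by (auto simp: starts_def opp)
    qed
    show ?thesis
      using 1 2 False sw_square[OF C'(2), of w] by (simp add: p push_not_starts opp)
  next
    case True
    then obtain v where v: "sw w (r # v)" by (auto simp: starts_def)
    have "\<not> starts ?P v"
    proof
      assume "starts ?P v"
      then obtain t where "sw v (?P # t)" by (auto simp: starts_def)
      then have "sw w (r # ?P # t)" using v sw.Cons sw_trans by blast
      then have "sw w (p # ?R # t)" using sw_square[OF C'(1), of t] sw_trans by blast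
      with assms(2) show False by (auto simp: starts_def)
    qed
    moreover have "sw (push ?P (push r w)) (push ?P v)"
      by (intro push_cong push_starts v)
    ultimately have R: "sw (push ?P (push r w)) (?P # v)" by (simp add: push_not_starts)
    have "sw (p # w) (p # r # v)" using v by (rule sw.Cons)
    moreover have "sw (p # r # v) (?R # ?P # v)"
      using sw_square[OF C'(4), of v] by (simp add: opp)
    ultimately have "sw (push ?R (push p w)) (?P # v)"
      unfolding p by (blast intro: push_starts sw_trans)
    with R show ?thesis by (blast intro: sw_sym sw_trans)
  qed
qed

text \<open>The letter nearest to \<open>w\<close> acts first, so this is the inverse of the square
  relation on \<open>p\<close> and \<open>r\<close>, the letters being involutions. If both letters
  can be cancelled, inversion of \<open>sw\<close> yields a common remainder
  \<open>z\<close>.\<close>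

lemma push_square:
  assumes "C p r"
  shows "sw (push (\<phi> p r) (push p w)) (push (\<phi> r p) (push r w))"
proof (cases "starts p w \<and> starts r w")
  case False
  then show ?thesis
    using push_square_not_starts[of p r w] push_square_not_starts[of r p w] assms
    by (blast intro: C_sym sw_sym)
next
  case True
  then obtain u v where uv: "sw w (p # u)" "sw w (r # v)" by (auto simp: starts_def)
  then have "sw (p # u) (r # v)" by (blast intro: sw_sym sw_trans)
  moreover have "p \<noteq> r" using assms C_irrefl by auto
  ultimately obtain z where z: "sw u (\<phi> p r # z)" "sw v (\<phi> r p # z)" by (metis sw_Cons_neqE)
  have "sw (push p w) (\<phi> p r # z)" "sw (push r w) (\<phi> r p # z)"
    using uv z by (blast intro: push_starts sw_trans)+
  then show ?thesis by (blast intro: push_starts sw_sym sw_trans)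
qed

section \<open>Reduced words\<close>

fun reduced :: "'a list \<Rightarrow> bool" where
  "reduced [] \<longleftrightarrow> True"
| "reduced (a # w) \<longleftrightarrow> reduced w \<and> \<not> starts a w"

text \<open>\<open>reduced\<close> inspects the suffixes of one representative, and exchanging the
  sides of a square changes these suffixes.\<close>

lemma reduced_cong: "sw u v \<Longrightarrow> reduced u \<Longrightarrow> reduced v"
proof (induction "length u" arbitrary: u v rule: less_induct)
  case less
  show ?case
  proof (cases u)
    case Nil
    then show ?thesis using less.prems by (simp add: sw_Nil_iff)
  next
    case (Cons a u')
    then obtain b v' where v: "v = b # v'" using sw_length[OF less.prems(1)] by (cases v) auto
    note len = sw_length[OF less.prems(1)]
    have red: "reduced u'" "\<not> starts a u'" using less.prems by (auto simp: Cons)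
    from less.prems(1)[unfolded Cons v] show ?thesis
    proof (cases rule: sw_cases)
      case 1: same
      then show ?thesis using less.hyps[of u' v'] red starts_cong[of u' v' a] by (auto simp: Cons v)
    next
      case 2: (square z)
      let ?a = "\<phi> b a" and ?b = "\<phi> a b"
      have z: "reduced z" "\<not> starts ?b z" using less.hyps[OF _ 2(2)] red by (auto simp: Cons)
      \<comment> \<open>Otherwise \<open>u'\<close> would begin with \<open>?b # ?a\<close>, which
        is one side of the square on \<open>?b\<close> and \<open>a\<close>; its other side begins
        with \<open>a\<close>, although \<open>a # u'\<close> is reduced.\<close>
      have "\<not> starts ?a z"
      proof
        assume "starts ?a z"
        then obtain t where "sw z (?a # t)" by (auto simp: starts_def)
        then have "sw u' (?b # ?a # t)" using 2(2) sw.Cons sw_trans by blast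
        moreover have "sw (?b # ?a # t) (a # \<phi> a ?b # t)"
          using sw_square[of ?b a t] 2(1) by (simp add: \<phi>_opposite \<phi>_\<phi> C_\<phi> C_sym)
        ultimately show False using red(2) sw_trans unfolding starts_def by blast
      qed
      then have "reduced (?a # z)" using z by simp
      then have "reduced v'"
        using less.hyps[OF _ sw_sym[OF 2(3)]] len sw_length[OF 2(3)] by (simp add: Cons v)
      \<comment> \<open>Otherwise \<open>z\<close> would begin with \<open>\<phi> ?a b\<close>,
        which is \<open>?b\<close>.\<close>
      moreover have "\<not> starts b v'"
      proof
        assume "starts b v'"
        then obtain t where "sw (?a # z) (b # t)"
          unfolding starts_def using 2(3) by (blast intro: sw_sym sw_trans)
        moreover have "?a \<noteq> b" using \<phi>_neq 2(1) C_sym by blast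
        ultimately obtain y where "sw z (\<phi> ?a b # y)" by (metis sw_Cons_neqE)
        then show False using z(2) 2(1) by (auto simp: starts_def \<phi>_opposite C_sym)
      qed
      ultimately show ?thesis by (simp add: v)
    qed
  qed
qed

lemma reduced_push: "reduced w \<Longrightarrow> reduced (push a w)"
  by (rule push_cases[of w a]) (auto dest: reduced_cong)

text \<open>Reducedness matters: starting from \<open>[a, a]\<close>, two pushes of \<open>a\<close>
  lead to the empty word.\<close>

lemma push_push: "reduced w \<Longrightarrow> sw (push a (push a w)) w"
proof (rule push_cases[of w a])
  assume "reduced w" and w: "sw w (a # push a w)"
  then have "\<not> starts a (push a w)" using reduced_cong by fastforce
  then show ?thesis using w by (simp add: push_not_starts sw_sym)
next
  assume "push a w = a # w"
  then show ?thesis by (auto intro: push_starts sw_refl)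
qed

text \<open>All these notions are built from \<open>C\<close>, \<open>\<phi>\<close> and equality of
  letters, so they commute with automorphisms of the square system. The symmetric group will act
  through such automorphisms.\<close>

lemma
  assumes "bij f"
    and C: "\<And>a b. C (f a) (f b) \<longleftrightarrow> C a b"
    and \<phi>: "\<And>a b. C a b \<Longrightarrow> \<phi> (f a) (f b) = f (\<phi> a b)"
  shows push_map: "push (f a) (map f w) = map f (push a w)"
    and sw_map: "sw u v \<Longrightarrow> sw (map f u) (map f v)"
    and reduced_map: "reduced w \<Longrightarrow> reduced (map f w)"
proof -
  have inj: "f a = f b \<longleftrightarrow> a = b" for a b using assms(1) by (simp add: bij_def inj_eq)
  have strip: "strip (f a) (map f w) = map_option (map f) (strip a w)" for a w
  proof (induction w arbitrary: a)
    case (Cons b w)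
    show ?case
      using Cons[of "\<phi> b a"] C_sym[of a b]
      by (cases "strip (\<phi> b a) w") (auto simp: inj C \<phi>)
  qed simp
  show "push (f a) (map f w) = map f (push a w)"
    by (simp add: push_def strip split: option.split)
  show "sw u v \<Longrightarrow> sw (map f u) (map f v)"
  proof (induction rule: sw.induct)
    case (square a b u z v)
    have "sw (map f u) (\<phi> (f a) (f b) # map f z)" "sw (map f v) (\<phi> (f b) (f a) # map f z)"
      using square C_sym by (auto simp: \<phi>)
    then show ?case using sw.square[of "f a" "f b"] square C by auto
  qed (auto intro: sw.intros)
  have "starts (f a) (map f w) \<longleftrightarrow> starts a w" for a w
  proof -
    have "starts b u \<longleftrightarrow> strip b u \<noteq> None" for b u
      using strip_Some strip_None unfolding starts_def by blast
    then show ?thesis by (simp add: strip)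
  qed
  then show "reduced w \<Longrightarrow> reduced (map f w)" by (induction w) auto
qed

end

section \<open>Sequences as generators\<close>

text \<open>On the interval from p to q this is the map x |-> p + q - x, the change of indices in
  (j3).\<close>

definition flip :: "'a list \<Rightarrow> 'a \<Rightarrow> 'a"
  where "flip a x = (case map_of (zip a (rev a)) x of None \<Rightarrow> x | Some y \<Rightarrow> y)"

lemma flip_id: "x \<notin> set a \<Longrightarrow> flip a x = x"
proof -
  assume "x \<notin> set a"
  then have "map_of (zip a (rev a)) x = None" by (subst map_of_zip_is_None) simp_all
  then show ?thesis unfolding flip_def by (simp only: option.case)
qed

lemma map_flip: "distinct a \<Longrightarrow> map (flip a) a = rev a"
proof (rule nth_equalityI)
  fix i assume "distinct a" "i < length (map (flip a) a)"
  then have "map_of (zip a (rev a)) (a ! i) = Some (rev a ! i)" and "i < length a"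
    using map_of_zip_nth[of a "rev a" i] by simp_all
  then show "map (flip a) a ! i = rev a ! i" by (simp only: flip_def nth_map option.case)
qed simp

lemma flip_flip:
  assumes "distinct a"
  shows "flip a (flip a x) = x"
proof (cases "x \<in> set a")
  case True
  have "map (flip a \<circ> flip a) a = map (flip a) (rev a)"
    by (simp only: map_flip[OF assms] list.map_comp[symmetric])
  also have "\<dots> = map id a" by (simp only: map_flip[OF assms] rev_rev_ident list.map_id rev_map[symmetric])
  finally show ?thesis using True by (simp only: map_eq_conv comp_apply id_apply)
qed (simp add: flip_id)

lemma flip_eqI:
  assumes "distinct a" "map f a = rev a" "\<And>x. x \<notin> set a \<Longrightarrow> f x = x"
  shows "flip a = f"
proof
  fix x
  show "flip a x = f x"
  proof (cases "x \<in> set a")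
    case True
    have "map (flip a) a = map f a" using assms by (simp add: map_flip)
    then show ?thesis using True by simp
  qed (simp add: assms(3) flip_id)
qed

lemma flip_rev: "distinct a \<Longrightarrow> flip (rev a) = flip a"
  by (rule flip_eqI) (simp_all add: map_flip flip_id rev_map[symmetric])

lemma flip_map:
  assumes "distinct a" "bij f"
  shows "flip (map f a) (f x) = f (flip a x)"
proof -
  have inv: "inv_into UNIV f (f x) = x" for x using assms(2) by (simp add: bij_def)
  have "flip (map f a) = (\<lambda>y. f (flip a (inv_into UNIV f y)))"
  proof (rule flip_eqI)
    show "distinct (map f a)" using assms by (metis bij_is_inj distinct_map inj_on_subset subset_UNIV)
    have "map (\<lambda>y. f (flip a (inv_into UNIV f y))) (map f a) = map f (map (flip a) a)"
      by (simp add: inv)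
    also have "\<dots> = rev (map f a)" using assms(1) by (simp add: map_flip rev_map)
    finally show "map (\<lambda>y. f (flip a (inv_into UNIV f y))) (map f a) = rev (map f a)" .
    fix y assume "y \<notin> set (map f a)"
    moreover have "f (inv_into UNIV f y) = y" using assms(2) by (simp add: bij_def surj_f_inv_f)
    ultimately have "inv_into UNIV f y \<notin> set a" by (metis image_eqI set_map)
    then show "f (flip a (inv_into UNIV f y)) = y" using \<open>f (inv_into UNIV f y) = y\<close> by (simp add: flip_id)
  qed
  then show ?thesis by (simp add: inv)
qed

lemma bij_flip: "distinct a \<Longrightarrow> bij (flip a)"
  by (rule o_bij[of "flip a"]) (auto simp: flip_flip)

lemma flip_in: "distinct a \<Longrightarrow> x \<in> set a \<Longrightarrow> flip a x \<in> set a"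
  by (metis image_eqI map_flip set_map set_rev)

text \<open>\<open>flip a\<close> alone would list the mirrored block backwards; \<open>rev\<close>
  restores the direction of \<open>a\<close>, so contiguous blocks of \<open>a\<close> go to
  contiguous blocks of \<open>a\<close>.\<close>

definition mirror :: "'a list \<Rightarrow> 'a list \<Rightarrow> 'a list"
  where "mirror a b = rev (map (flip a) b)"

lemma mirror_mirror: "distinct a \<Longrightarrow> mirror a (mirror a b) = b"
  by (simp add: mirror_def flip_flip comp_def rev_map[symmetric])

lemma mirror_self: "distinct a \<Longrightarrow> mirror a a = a"
  by (simp add: mirror_def map_flip)

lemma mirror_Nil_iff: "mirror a b = [] \<longleftrightarrow> b = []"
  by (simp add: mirror_def)

lemma distinct_mirror: "distinct a \<Longrightarrow> distinct (mirror a b) \<longleftrightarrow> distinct b"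
  using inj_on_subset[OF bij_is_inj[OF bij_flip] subset_UNIV, of a "set b"]
  by (auto simp: mirror_def distinct_map)

lemma set_mirror: "set (mirror a b) = flip a ` set b"
  by (simp add: mirror_def)

lemma set_mirror_subset: "distinct a \<Longrightarrow> set b \<subseteq> set a \<Longrightarrow> set (mirror a b) \<subseteq> set a"
  by (auto simp: set_mirror flip_in)

lemma sublist_mirror: "sublist b c \<Longrightarrow> sublist (mirror a b) (mirror a c)"
  by (simp add: mirror_def map_mono_sublist)

lemma sublist_mirror_iff: "distinct a \<Longrightarrow> sublist (mirror a b) (mirror a c) \<longleftrightarrow> sublist b c"
  using sublist_mirror[of b c a] sublist_mirror[of "mirror a b" "mirror a c" a]
  by (auto simp: mirror_mirror)

lemma sublist_mirror_self: "distinct a \<Longrightarrow> sublist (mirror a b) a \<longleftrightarrow> sublist b a"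
  using sublist_mirror_iff[of a b a] by (simp add: mirror_self)

lemma mirror_map:
  assumes "distinct a" "bij f"
  shows "mirror (map f a) (map f b) = map f (mirror a b)"
  by (simp add: mirror_def rev_map flip_map[OF assms])

text \<open>\<open>flip\<close> does not see the direction of a sequence, so the flip of
  \<open>mirror b a\<close> is the flip of \<open>a\<close> conjugated by \<open>flip b\<close>.
  This is the cube axiom for nested blocks.\<close>

lemma mirror_mirror_swap:
  assumes "distinct a" "distinct b" "sublist a b"
  shows "mirror (mirror b a) (mirror b c) = mirror b (mirror a c)"
proof -
  have "flip (mirror b a) = flip (map (flip b) a)"
    unfolding mirror_def
    using distinct_mirror[OF assms(2), of a] assms(1) by (intro flip_rev) (simp add: mirror_def)
  then show ?thesis
    using flip_map[OF assms(1) bij_flip[OF assms(2)]] by (simp add: mirror_def rev_map)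
qed

text \<open>
  A sequence \<open>[\<sigma> 1, ..., \<sigma> k]\<close> stands for the conjugate of \<open>x\<^sub>1\<^sub>,\<^sub>k\<close> by the permutation \<open>\<sigma>\<close>;
  in particular \<open>[p..<Suc q]\<close> stands for \<open>x\<^sub>p\<^sub>,\<^sub>q\<close>.
\<close>

definition compatible :: "'a list \<Rightarrow> 'a list \<Rightarrow> bool"
  where "compatible a b \<longleftrightarrow> a \<noteq> b \<and> a \<noteq> [] \<and> b \<noteq> [] \<and> distinct a \<and> distinct b \<and>
    (sublist a b \<or> sublist b a \<or> set a \<inter> set b = {})"

text \<open>The map \<open>\<phi>\<close> of the square system. In the square of a nested pair only
  the smaller letter changes, and in that of a disjoint pair neither does.\<close>

definition transport :: "'a list \<Rightarrow> 'a list \<Rightarrow> 'a list"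
  where "transport a b = (if sublist b a then mirror a b else b)"

lemma disjoint_not_sublist: "a \<noteq> [] \<Longrightarrow> set a \<inter> set b = {} \<Longrightarrow> \<not> sublist a b"
  by (metis inf.orderE set_empty set_mono_sublist)

lemma compatible_cases [consumes 1, case_names below above disjoint]:
  assumes "compatible a b"
    and "sublist a b \<Longrightarrow> \<not> sublist b a \<Longrightarrow> P"
    and "sublist b a \<Longrightarrow> \<not> sublist a b \<Longrightarrow> P"
    and "set a \<inter> set b = {} \<Longrightarrow> \<not> sublist a b \<Longrightarrow> \<not> sublist b a \<Longrightarrow> P"
  shows P
proof -
  have "a \<noteq> b" "a \<noteq> []" "b \<noteq> []" using assms(1) by (auto simp: compatible_def)
  moreover have "sublist a b \<or> sublist b a \<or> set a \<inter> set b = {}"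
    using assms(1) by (simp add: compatible_def)
  moreover have "\<not> (sublist a b \<and> sublist b a)"
    using \<open>a \<noteq> b\<close> sublist_order.order.antisym by blast
  moreover have "set b \<inter> set a = {}" if "set a \<inter> set b = {}" using that by blast
  ultimately show P
    using disjoint_not_sublist[of a b] disjoint_not_sublist[of b a] assms(2-4) by argo
qed

lemma compatible_map: "bij f \<Longrightarrow> compatible (map f a) (map f b) \<longleftrightarrow> compatible a b"
proof -
  assume f: "bij f"
  then have inj: "inj f" by (simp add: bij_def)
  have "sublist (map f a) (map f b) \<longleftrightarrow> sublist a b" for a b
  proof
    assume "sublist (map f a) (map f b)"
    then have "sublist (map (inv_into UNIV f) (map f a)) (map (inv_into UNIV f) (map f b))" by (rule map_mono_sublist)
    then show "sublist a b" by (simp add: inj)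
  qed (rule map_mono_sublist)
  moreover have "inj_on f A" for A using inj by (rule inj_on_subset) simp
  ultimately show ?thesis
    using inj by (simp add: compatible_def distinct_map inj_map_eq_map image_Int[symmetric])
qed

lemma transport_map:
  "bij f \<Longrightarrow> compatible a b \<Longrightarrow> transport (map f a) (map f b) = map f (transport a b)"
proof -
  assume f: "bij f" and "compatible a b"
  then have "distinct a" by (simp add: compatible_def)
  have "sublist (map f b) (map f a) \<longleftrightarrow> sublist b a"
  proof
    assume "sublist (map f b) (map f a)"
    then have "sublist (map (inv_into UNIV f) (map f b)) (map (inv_into UNIV f) (map f a))" by (rule map_mono_sublist)
    then show "sublist b a" using f by (simp add: bij_def)
  qed (rule map_mono_sublist)
  then show ?thesis using f \<open>distinct a\<close> by (simp add: transport_def mirror_map)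
qed

lemma compatible_sym: "compatible a b \<Longrightarrow> compatible b a"
  by (auto simp: compatible_def)

lemma disjoint_mirror:
  "distinct a \<Longrightarrow> set b \<subseteq> set a \<Longrightarrow> set a \<inter> set c = {} \<Longrightarrow> set (mirror a b) \<inter> set c = {}"
  using Int_mono[OF set_mirror_subset[of a b] order_refl[of "set c"]] by simp

lemma compatible_transport:
  assumes "compatible a b"
  shows "compatible a (transport a b)"
proof (cases "sublist b a")
  case True
  have ab: "a \<noteq> []" "b \<noteq> []" "distinct a" "distinct b" "a \<noteq> b"
    using assms by (auto simp: compatible_def)
  then have "a \<noteq> mirror a b" by (metis mirror_mirror mirror_self)
  moreover have "sublist (mirror a b) a" using True ab by (simp add: sublist_mirror_self)
  moreover have "distinct (mirror a b)" "mirror a b \<noteq> []"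
    using ab by (simp_all add: distinct_mirror mirror_Nil_iff)
  ultimately have "compatible a (mirror a b)" using ab unfolding compatible_def by blast
  then show ?thesis using True by (simp add: transport_def)
qed (use assms in \<open>simp add: transport_def\<close>)

text \<open>If both letters lie in \<open>a\<close>, both are mirrored. If only \<open>b\<close>
  does, then \<open>c\<close> contains \<open>a\<close> or is disjoint from it, and so contains or
  misses every block of \<open>a\<close>, in particular the mirrored one.\<close>

lemma compatible_transport_transport:
  assumes "compatible a b" "compatible a c" "compatible b c"
  shows "compatible (transport a b) (transport a c)"
proof -
  have d: "distinct a" using assms by (simp add: compatible_def)
  have *: "compatible (mirror a b) c" if "sublist b a" "\<not> sublist c a" "compatible a b" "compatible a c" for b c
    using that(4)
  proof (cases rule: compatible_cases)
    case below
    have "sublist (mirror a b) c" using that below d sublist_mirror_self sublist_order.order_trans by blast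
    moreover have "mirror a b \<noteq> c" using that d sublist_mirror_self by blast
    ultimately show ?thesis
      using that d by (auto simp: compatible_def distinct_mirror mirror_Nil_iff)
  next
    case disjoint
    have "set (mirror a b) \<inter> set c = {}"
      using disjoint_mirror[OF d set_mono_sublist[OF that(1)] disjoint(1)] .
    moreover have "mirror a b \<noteq> c" using that d sublist_mirror_self by blast
    ultimately show ?thesis
      using that d by (auto simp: compatible_def distinct_mirror mirror_Nil_iff)
  qed (use that in auto)
  show ?thesis
  proof (cases "sublist b a"; cases "sublist c a")
    assume "sublist b a" "sublist c a"
    moreover have "mirror a b \<noteq> mirror a c" using assms(3) d by (metis compatible_def mirror_mirror)
    moreover have "set (mirror a b) \<inter> set (mirror a c) = flip a ` (set b \<inter> set c)"
      using bij_flip[OF d] by (simp add: set_mirror bij_def image_Int)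
    ultimately show ?thesis
      using assms(3) d
      by (auto simp: transport_def compatible_def distinct_mirror mirror_Nil_iff sublist_mirror_iff)
  next
    assume "sublist b a" "\<not> sublist c a"
    then show ?thesis using * assms by (simp add: transport_def)
  next
    assume "\<not> sublist b a" "sublist c a"
    then show ?thesis using *[of c b] assms compatible_sym by (auto simp: transport_def)
  next
    assume "\<not> sublist b a" "\<not> sublist c a"
    then show ?thesis using assms by (simp add: transport_def)
  qed
qed

text \<open>A letter changes only when it crosses one that contains it. If \<open>c\<close> lies in
  just one of \<open>a\<close> and \<open>b\<close>, both paths mirror it once in that letter. If it
  lies in both, these are not disjoint, hence nested, and \<open>mirror_mirror_swap\<close> matches
  the two paths.\<close>

lemma transport_cube:
  assumes "compatible a b" "compatible a c" "compatible b c"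
  shows "transport (transport a b) (transport a c) = transport (transport b a) (transport b c)"
proof -
  have both: "transport (transport a b) (transport a c) = transport (transport b a) (transport b c)"
    if "sublist a b" "\<not> sublist b a" "sublist c a" "compatible a b" for a b c :: "'a list"
  proof -
    have "sublist c b" using that sublist_order.order_trans by blast
    moreover have "sublist (mirror a c) b"
      using that sublist_mirror_self sublist_order.order_trans by (metis compatible_def)
    moreover have "sublist (mirror b c) (mirror b a)" using that by (simp add: sublist_mirror)
    ultimately show ?thesis
      using that mirror_mirror_swap[of a b c] by (simp add: transport_def compatible_def)
  qed
  have one: "transport (transport a b) (transport a c) = transport (transport b a) (transport b c)"
    if "sublist c a" "\<not> sublist c b" "compatible a b" "compatible a c" for a b c :: "'a list"
    using that(3)
  proof (cases rule: compatible_cases)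
    case below
    then show ?thesis using that sublist_order.order_trans by blast
  next
    case above
    have "\<not> sublist (mirror a c) (mirror a b)"
      using that sublist_mirror_iff by (metis compatible_def)
    then show ?thesis using that above by (simp add: transport_def)
  next
    case disjoint
    have "set (mirror a c) \<inter> set b = {}"
      using that disjoint_mirror[OF _ set_mono_sublist[OF that(1)] disjoint(1)]
      by (simp add: compatible_def)
    then have "\<not> sublist (mirror a c) b"
      using that by (intro disjoint_not_sublist) (auto simp: compatible_def mirror_Nil_iff)
    then show ?thesis using that disjoint by (simp add: transport_def)
  qed
  have ba: "compatible b a" using assms compatible_sym by blast
  show ?thesis
  proof (cases "sublist c a"; cases "sublist c b")
    assume c: "sublist c a" "sublist c b"
    from assms(1) show ?thesis
    proof (cases rule: compatible_cases)
      case below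
      then show ?thesis using both c assms by blast
    next
      case above
      then show ?thesis using both[of b a c] c ba by simp
    next
      case disjoint
      have "set c \<subseteq> set a \<inter> set b" using c by (simp add: set_mono_sublist)
      then show ?thesis using disjoint assms by (simp add: compatible_def)
    qed
  next
    assume "sublist c a" "\<not> sublist c b"
    then show ?thesis using one assms by blast
  next
    assume "\<not> sublist c a" "sublist c b"
    then show ?thesis using one[of c b a] assms ba by simp
  next
    assume c: "\<not> sublist c a" "\<not> sublist c b"
    have "transport (transport x y) c = c"
      if "\<not> sublist c x" "\<not> sublist c y" "distinct x" for x y
      using that sublist_mirror_self[of x y] sublist_order.order_trans[of c "mirror x y" x]
      by (auto simp: transport_def)
    moreover have "distinct a" "distinct b" using assms by (auto simp: compatible_def)
    moreover have "transport a c = c" "transport b c = c" using c by (simp_all add: transport_def)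
    ultimately show ?thesis using c by simp
  qed
qed

lemma transport_opposite: "compatible a b \<Longrightarrow> transport (transport a b) a = transport b a"
proof -
  assume C: "compatible a b"
  then show ?thesis
  proof (cases rule: compatible_cases)
    case above
    have "distinct a" "a \<noteq> b" using C by (auto simp: compatible_def)
    then have "mirror a b \<noteq> a" by (metis mirror_mirror mirror_self)
    then have "\<not> sublist a (mirror a b)"
      using above \<open>distinct a\<close> sublist_mirror_self[of a b] sublist_order.order.antisym by blast
    then show ?thesis using above by (simp add: transport_def)
  qed (simp_all add: transport_def)
qed

interpretation seq: square_system compatible transport
proof
  fix a b c :: "'a list"
  show "\<not> compatible a a" by (simp add: compatible_def)
  show "compatible a b \<Longrightarrow> compatible b a" by (rule compatible_sym)
  show "compatible a b \<Longrightarrow> compatible a (transport a b)" by (rule compatible_transport)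
  show "compatible a b \<Longrightarrow> transport a (transport a b) = b"
    by (auto simp: compatible_def transport_def mirror_mirror sublist_mirror_self)
  show "compatible a b \<Longrightarrow> transport (transport a b) a = transport b a" by (rule transport_opposite)
  show "compatible a b \<Longrightarrow> compatible a c \<Longrightarrow> compatible b c \<Longrightarrow> compatible (transport a b) (transport a c)"
    by (rule compatible_transport_transport)
  show "compatible a b \<Longrightarrow> compatible a c \<Longrightarrow> compatible b c \<Longrightarrow>
      transport (transport a b) (transport a c) = transport (transport b a) (transport b c)"
    by (rule transport_cube)
qed

section \<open>An action of the virtual cactus group\<close>

definition tr :: "nat \<Rightarrow> nat \<Rightarrow> nat"
  where "tr i = transpose i (Suc i)"

definition perm :: "nat list \<Rightarrow> nat \<Rightarrow> nat"
  where "perm is x = foldr tr is x"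

definition rhos :: "nat list \<Rightarrow> vj_gen word"
  where "rhos is = map (\<lambda>i. (GenRho i, True)) is"

type_synonym state = "nat list \<times> nat list list"

text \<open>Left multiplication, where \<open>(s, w)\<close> stands for the product of the X_a over
  the letters a of \<open>w\<close>, followed by the permutation with value list \<open>s\<close>.
  Moving a permutation to the right past X_a replaces a by its image.\<close>

fun act1 :: "vj_gen \<Rightarrow> state \<Rightarrow> state" where
  "act1 (GenX p q) (s, w) = (s, seq.push [p..<Suc q] w)"
| "act1 (GenRho i) (s, w) = (map (tr i) s, map (map (tr i)) w)"

text \<open>Exponents are dropped because all generators are involutions; \<open>foldr\<close> lets
  the last letter act first, as in a left action.\<close>

definition act :: "vj_gen word \<Rightarrow> state \<Rightarrow> state"
  where "act u st = foldr (\<lambda>l. act1 (fst l)) u st"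

definition state_eq :: "state \<Rightarrow> state \<Rightarrow> bool"
  where "state_eq x y \<longleftrightarrow> fst x = fst y \<and> seq.sw (snd x) (snd y)"

lemma tr_tr: "tr i (tr i x) = x"
  by (simp add: tr_def)

lemma bij_tr: "bij (tr i)"
  by (simp add: tr_def)

lemma perm_Nil [simp]: "perm [] x = x"
  by (simp add: perm_def)

lemma perm_Cons [simp]: "perm (i # is) x = tr i (perm is x)"
  by (simp add: perm_def)

lemma perm_append: "perm (is @ js) x = perm is (perm js x)"
  by (simp add: perm_def)

lemma bij_perm: "bij (perm is)"
proof (induction "is")
  case Nil
  have "perm [] = id" by (simp add: fun_eq_iff)
  then show ?case by (simp only: bij_id)
next
  case (Cons i "is")
  have "perm (i # is) = tr i \<circ> perm is" by (simp add: fun_eq_iff)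
  then show ?case using Cons bij_tr by (metis bij_comp)
qed

text \<open>For \<open>p \<le> k\<close> the descending product is the cycle that takes
  \<open>p\<close> to \<open>k\<close> and moves the points after \<open>p\<close> up to
  \<open>k\<close> down by one. This is the shift of indices in (m2).\<close>

lemma perm_down: "perm (rev [p..<k]) (Suc x) = (if p \<le> x \<and> x < k then x else Suc x)" if "p \<le> x"
proof (cases "p \<le> k")
  case True
  then show ?thesis using that
    by (induction k rule: dec_induct) (auto simp: tr_def transpose_def)
qed (use that in simp)

lemma bij_map: "bij f \<Longrightarrow> bij (map f)"
  by (rule o_bij[of "map (inv_into UNIV f)"]) (auto simp: fun_eq_iff comp_def bij_def surj_f_inv_f)

lemma push_map_map:
  fixes f :: "'a \<Rightarrow> 'a"
  shows "bij f \<Longrightarrow> seq.push (map f a) (map (map f) w) = map (map f) (seq.push a w)"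
  by (rule seq.push_map[where f = "map f"]) (auto simp: bij_map compatible_map transport_map)

lemma sw_map_map:
  fixes f :: "'a \<Rightarrow> 'a"
  shows "bij f \<Longrightarrow> seq.sw u v \<Longrightarrow> seq.sw (map (map f) u) (map (map f) v)"
  by (rule seq.sw_map[where f = "map f"]) (auto simp: bij_map compatible_map transport_map)

lemma reduced_map_map:
  fixes f :: "'a \<Rightarrow> 'a"
  shows "bij f \<Longrightarrow> seq.reduced w \<Longrightarrow> seq.reduced (map (map f) w)"
  by (rule seq.reduced_map[where f = "map f"]) (auto simp: bij_map compatible_map transport_map)

lemma state_eq_refl: "state_eq x x"
  by (simp add: state_eq_def seq.sw_refl)

lemma state_eq_sym: "state_eq x y \<Longrightarrow> state_eq y x"
  by (simp add: state_eq_def seq.sw_sym)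

lemma state_eq_trans: "state_eq x y \<Longrightarrow> state_eq y z \<Longrightarrow> state_eq x z"
  unfolding state_eq_def by (metis seq.sw_trans)

lemma act1_cong: "state_eq x y \<Longrightarrow> state_eq (act1 g x) (act1 g y)"
  by (cases g; cases x; cases y)
    (auto simp: state_eq_def seq.push_cong sw_map_map bij_tr simp del: upt_Suc)

lemma act1_reduced: "seq.reduced (snd x) \<Longrightarrow> seq.reduced (snd (act1 g x))"
  by (cases g; cases x) (auto simp: seq.reduced_push reduced_map_map bij_tr simp del: upt_Suc)

lemma act_Nil: "act [] x = x"
  by (simp add: act_def)

lemma act_Cons: "act (l # u) x = act1 (fst l) (act u x)"
  by (simp add: act_def)

lemma act_append: "act (u @ v) x = act u (act v x)"
  by (simp add: act_def)

lemma act_cong: "state_eq x y \<Longrightarrow> state_eq (act u x) (act u y)"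
  by (induction u) (auto simp: act_Nil act_Cons act1_cong)

lemma act_reduced: "seq.reduced (snd x) \<Longrightarrow> seq.reduced (snd (act u x))"
  by (induction u) (auto simp: act_Nil act_Cons act1_reduced)

lemma act_rhos: "act (rhos is) (s, w) = (map (perm is) s, map (map (perm is)) w)"
  by (induction "is") (auto simp: rhos_def act_Nil act_Cons)

lemma rho_down_rhos: "rho_down q p = rhos (rev [p..<Suc q])"
proof -
  have "concat (map rhow xs) = rhos xs" for xs by (induction xs) (auto simp: rhos_def)
  then show ?thesis by (simp only: rho_down_def)
qed

lemma flip_interval: "p \<le> x \<Longrightarrow> x \<le> q \<Longrightarrow> flip [p..<Suc q] x = p + q - x"
proof -
  assume x: "p \<le> x" "x \<le> q"
  have "flip [p..<Suc q] = (\<lambda>x. if p \<le> x \<and> x \<le> q then p + q - x else x)"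
  proof (rule flip_eqI)
    show "map (\<lambda>x. if p \<le> x \<and> x \<le> q then p + q - x else x) [p..<Suc q] = rev [p..<Suc q]"
      by (rule nth_equalityI) (auto simp: rev_nth simp del: upt_Suc)
  qed (auto simp del: upt_Suc)
  then show ?thesis using x by simp
qed

lemma mirror_interval:
  assumes "p \<le> m" "m \<le> r" "r \<le> q"
  shows "mirror [p..<Suc q] [m..<Suc r] = [p + q - r..<Suc (p + q - m)]"
  unfolding mirror_def
  by (rule nth_equalityI) (use assms in \<open>auto simp: rev_nth flip_interval simp del: upt_Suc\<close>)

lemma sublist_interval:
  assumes "p \<le> m" "m \<le> r" "r \<le> q"
  shows "sublist [m..<Suc r] [p..<Suc q]"
proof -
  have "[p..<Suc q] = [p..<m] @ [m..<Suc r] @ [Suc r..<Suc q]"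
    using upt_add_eq_append[of p m "Suc q - m"] upt_add_eq_append[of m "Suc r" "q - r"] assms
    by (simp del: upt_Suc)
  then show ?thesis by (metis sublist_appendI)
qed

lemma transport_interval_below:
  assumes "p \<le> m" "m < r" "r \<le> q" "(m, r) \<noteq> (p, q)"
  shows "compatible [p..<Suc q] [m..<Suc r]"
    and "transport [p..<Suc q] [m..<Suc r] = [p + q - r..<Suc (p + q - m)]"
    and "transport [m..<Suc r] [p..<Suc q] = [p..<Suc q]"
proof -
  have ne: "[p..<Suc q] \<noteq> [m..<Suc r]"
  proof
    assume eq: "[p..<Suc q] = [m..<Suc r]"
    have "hd [p..<Suc q] = p" "last [p..<Suc q] = q" "hd [m..<Suc r] = m" "last [m..<Suc r] = r"
      using assms by (simp_all add: hd_upt)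
    with eq assms(4) show False by metis
  qed
  have sub: "sublist [m..<Suc r] [p..<Suc q]" using assms by (intro sublist_interval) auto
  show c: "compatible [p..<Suc q] [m..<Suc r]"
    unfolding compatible_def using ne sub assms by (simp del: upt_Suc)
  show "transport [p..<Suc q] [m..<Suc r] = [p + q - r..<Suc (p + q - m)]"
    using sub mirror_interval assms by (simp add: transport_def)
  have "\<not> sublist [p..<Suc q] [m..<Suc r]" using ne sub sublist_order.order.antisym by blast
  then show "transport [m..<Suc r] [p..<Suc q] = [p..<Suc q]" by (simp add: transport_def)
qed

lemma transport_disjoint:
  assumes "a \<noteq> []" "b \<noteq> []" "distinct a" "distinct b" "set a \<inter> set b = {}"
  shows "compatible a b" and "transport a b = b" and "transport b a = a"
proof -
  show "compatible a b" unfolding compatible_def using assms by auto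
  show "transport a b = b" "transport b a = a"
    using assms disjoint_not_sublist[of b a] disjoint_not_sublist[of a b]
    by (auto simp: transport_def Int_commute)
qed

lemma act_rel:
  assumes "(u, v) \<in> vj_rels n" "seq.reduced (snd x)"
  shows "state_eq (act u x) (act v x)"
proof -
  obtain s w where x: "x = (s, w)" by force
  note act_simps = act_Nil act_Cons act_append x state_eq_def seq.sw_refl
  from assms(1) show ?thesis
  proof cases
    case (j1 p q)
    then show ?thesis using seq.push_push assms(2) by (simp add: act_simps del: upt_Suc)
  next
    case (j2 p q m r)
    have "set [p..<Suc q] \<inter> set [m..<Suc r] = {}"
      using j2 by (simp add: atLeastLessThanSuc_atLeastAtMost del: upt_Suc)
    then have "compatible [m..<Suc r] [p..<Suc q]"
      "transport [m..<Suc r] [p..<Suc q] = [p..<Suc q]"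
      "transport [p..<Suc q] [m..<Suc r] = [m..<Suc r]"
      using j2 transport_disjoint[of "[m..<Suc r]" "[p..<Suc q]"] by (simp_all add: Int_commute del: upt_Suc)
    then show ?thesis
      using seq.push_square[of "[m..<Suc r]" "[p..<Suc q]" w] j2 by (simp add: act_simps del: upt_Suc)
  next
    case (j3 p q m r)
    have mr: "p \<le> m" "r \<le> q" using j3 by auto
    show ?thesis
    proof (cases "(m, r) = (p, q)")
      case True
      \<comment> \<open>Equal intervals are not compatible, but here (j3) has the same word on both
        sides.\<close>
      then show ?thesis using j3 by (simp add: act_simps)
    next
      case False
      note t = transport_interval_below[OF mr(1) \<open>m < r\<close> mr(2) False]
      \<comment> \<open>The right factor acts first, so the square is used with the two intervals
        exchanged.\<close>
      show ?thesis
        using seq.push_square[OF compatible_sym[OF t(1)], of w] t j3 by (simp add: act_simps del: upt_Suc)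
    qed
  next
    case (s1 i)
    then show ?thesis by (simp add: act_simps comp_def tr_tr)
  next
    case (s2 i j)
    then have "j = Suc i \<or> i = Suc j" by linarith
    then have "tr i (tr j (tr i y)) = tr j (tr i (tr j y))" for y
      by (auto simp: tr_def transpose_def)
    then show ?thesis using s2 by (simp add: act_simps comp_def)
  next
    case (s3 i j)
    then have "tr i (tr j y) = tr j (tr i y)" for y
      by (auto simp: tr_def transpose_def)
    then show ?thesis using s3 by (simp add: act_simps comp_def)
  next
    case (m1 p q i)
    then have "map (tr i) [p..<Suc q] = [p..<Suc q]"
      by (intro map_idI) (auto simp: tr_def transpose_def simp del: upt_Suc)
    then show ?thesis using m1 push_map_map[OF bij_tr[of i], of "[p..<Suc q]" w]
      by (simp add: act_simps del: upt_Suc)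
  next
    case (m2 p q)
    let ?c = "perm (rev [p..<Suc q])"
    have "map ?c [Suc p..<Suc (Suc q)] = map (?c \<circ> Suc) [p..<Suc q]"
      by (metis map_Suc_upt map_map)
    also have "\<dots> = [p..<Suc q]"
      by (intro map_idI) (auto simp: perm_down simp del: upt_Suc)
    finally have "map ?c [Suc p..<Suc (Suc q)] = [p..<Suc q]" .
    then show ?thesis
      using m2 push_map_map[OF bij_perm, of "rev [p..<Suc q]" "[Suc p..<Suc (Suc q)]" w]
      by (simp add: act_simps rho_down_rhos act_rhos del: upt_Suc)
  qed
qed

text \<open>Cancelling a letter against its inverse is \<open>push_push\<close>, hence the
  restriction to reduced states; the rule \<open>cong\<close> then needs that \<open>act\<close>
  preserves reducedness.\<close>

theorem act_pres_eq:
  assumes "pres_eq (vj_gens n) (vj_rels n) u v" "seq.reduced (snd x)"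
  shows "state_eq (act u x) (act v x)"
  using assms
proof (induction arbitrary: x rule: pres_eq.induct)
  case (rel u v)
  then show ?case by (simp add: act_rel)
next
  case (cancel g b)
  obtain s w where x: "x = (s, w)" by force
  show ?case
    using cancel seq.push_push
    by (cases g) (auto simp: act_Nil act_Cons x state_eq_def seq.sw_refl comp_def tr_tr simp del: upt_Suc)
next
  case (refl u)
  then show ?case by (simp add: state_eq_refl)
next
  case (sym u v)
  then show ?case by (simp add: state_eq_sym)
next
  case (trans u v w)
  then show ?case using state_eq_trans by blast
next
  case (cong u u' v v')
  have "state_eq (act u (act v x)) (act u' (act v x))" using cong act_reduced by blast
  moreover have "state_eq (act u' (act v x)) (act u' (act v' x))" using cong act_cong by blast
  ultimately show ?case unfolding act_append by (rule state_eq_trans)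
qed

section \<open>Faithfulness of the action\<close>

text \<open>Index words in the transpositions from \<open>m\<close> to \<open>n - 1\<close>:
  \<open>idx 1 n\<close> serves for S_n, and \<open>idx (Suc k) n\<close> for the subgroup fixing 1,
  ..., k.\<close>

abbreviation idx :: "nat \<Rightarrow> nat \<Rightarrow> nat list set"
  where "idx m n \<equiv> {is. set is \<subseteq> {m..<n}}"

lemma perm_rev_perm: "perm (rev is) (perm is x) = x"
  by (induction "is" arbitrary: x) (auto simp: perm_append tr_tr)

lemma perm_perm_rev: "perm is (perm (rev is) x) = x"
  using perm_rev_perm[of "rev is"] by simp

lemma perm_fix: "\<forall>i\<in>set is. i \<noteq> x \<and> Suc i \<noteq> x \<Longrightarrow> perm is x = x"
  by (induction "is") (auto simp: tr_def transpose_def)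

lemma perm_range: "is \<in> idx 1 n \<Longrightarrow> x \<in> {1..n} \<Longrightarrow> perm is x \<in> {1..n}"
  by (induction "is") (auto simp: tr_def transpose_def)

lemma perm_down_first: "m \<le> z \<Longrightarrow> perm (rev [m..<z]) m = z"
  by (induction z rule: dec_induct) (auto simp: tr_def transpose_def)

definition seqs :: "nat \<Rightarrow> nat list set"
  where "seqs n = {a. distinct a \<and> set a \<subseteq> {1..n} \<and> 2 \<le> length a}"

text \<open>The word is extended term by term. If it already places the first k terms, the next term
  is the image of some z > k, and a descending cycle, applied beforehand, takes k + 1 to z without
  touching 1, ..., k.\<close>

lemma transitive:
  assumes "distinct a" "set a \<subseteq> {1..n}"
  shows "\<exists>js\<in>idx 1 n. map (perm js) [1..<Suc (length a)] = a"
  using assms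
proof (induction a rule: rev_induct)
  case Nil
  then show ?case by (intro bexI[of _ "[]"]) auto
next
  case (snoc y a)
  then obtain js where js: "js \<in> idx 1 n" "map (perm js) [1..<Suc (length a)] = a" by auto
  define z where "z = perm (rev js) y"
  have y: "perm js z = y" by (simp add: z_def perm_perm_rev)
  have "z \<in> {1..n}"
    unfolding z_def by (rule perm_range) (use js snoc.prems in auto)
  moreover have "\<not> z < Suc (length a)"
  proof
    assume "z < Suc (length a)"
    then have "perm js z \<in> set (map (perm js) [1..<Suc (length a)])"
      using \<open>z \<in> {1..n}\<close> by (simp del: upt_Suc)
    then have "y \<in> set a" unfolding js(2) y .
    then show False using snoc.prems by simp
  qed
  ultimately have z: "Suc (length a) \<le> z" "z \<le> n" by auto
  let ?d = "rev [Suc (length a)..<z]"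
  have "map (perm (js @ ?d)) [1..<Suc (length a)] = map (perm js) [1..<Suc (length a)]"
    unfolding map_eq_conv perm_append by (intro ballI arg_cong[of _ _ "perm js"] perm_fix) auto
  moreover have "perm (js @ ?d) (Suc (length a)) = y"
    using z by (simp add: perm_append perm_down_first y)
  moreover have "[1..<Suc (length (a @ [y]))] = [1..<Suc (length a)] @ [Suc (length a)]" by simp
  ultimately have "map (perm (js @ ?d)) [1..<Suc (length (a @ [y]))] = a @ [y]"
    using js by (simp only: map_append list.map)
  moreover have "js @ ?d \<in> idx 1 n" using js z by auto
  ultimately show ?case by blast
qed

context
  fixes n :: nat
begin

interpretation G: group "VJ n"
  unfolding VJ_def by (rule pres_group_is_group)

abbreviation el :: "vj_gen word \<Rightarrow> vj_gen word set" where "el \<equiv> vj_elem n"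
abbreviation mult (infixl "\<cdot>" 70) where "g \<cdot> h \<equiv> g \<otimes>\<^bsub>VJ n\<^esub> h"
abbreviation unit where "unit \<equiv> \<one>\<^bsub>VJ n\<^esub>"
abbreviation W where "W \<equiv> words (vj_gens n)"
abbreviation I where "I \<equiv> idx 1 n"

lemma words_append: "u \<in> W \<Longrightarrow> v \<in> W \<Longrightarrow> u @ v \<in> W"
  by (simp add: words_def)

lemma el_carrier: "u \<in> W \<Longrightarrow> el u \<in> carrier (VJ n)"
  by (simp add: VJ_def pres_group_def vj_elem_def)

lemma el_append: "u \<in> W \<Longrightarrow> v \<in> W \<Longrightarrow> el (u @ v) = el u \<cdot> el v"
  by (simp add: VJ_def pres_group_mult vj_elem_def)

lemma el_Nil: "el [] = unit"
  by (simp add: VJ_def pres_group_def vj_elem_def)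

lemma el_eq_iff: "u \<in> W \<Longrightarrow> el u = el v \<longleftrightarrow> pres_eq (vj_gens n) (vj_rels n) u v"
  by (simp add: vj_elem_def word_class_eq_iff)

lemma el_rel: "(u, v) \<in> vj_rels n \<Longrightarrow> el u = el v"
  using vj_rels_words[of u v n] by (simp add: el_eq_iff pres_eq.rel)

definition rho_elem :: "nat list \<Rightarrow> vj_gen word set"
  where "rho_elem is = el (rhos is)"

definition x_elem :: "nat \<Rightarrow> nat \<Rightarrow> vj_gen word set"
  where "x_elem p q = el (xw p q)"

lemma rhos_words: "is \<in> I \<Longrightarrow> rhos is \<in> W"
  by (induction "is") (auto simp: rhos_def words_def vj_gens_def)

lemma rhos_append: "rhos (is @ js) = rhos is @ rhos js"
  by (simp add: rhos_def)

lemma rho_elem_carrier: "is \<in> I \<Longrightarrow> rho_elem is \<in> carrier (VJ n)"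
  by (simp add: rho_elem_def el_carrier rhos_words)

lemma rho_elem_append: "is \<in> I \<Longrightarrow> js \<in> I \<Longrightarrow> rho_elem (is @ js) = rho_elem is \<cdot> rho_elem js"
  by (simp add: rho_elem_def rhos_append el_append rhos_words)

lemma rho_elem_Nil: "rho_elem [] = unit"
  by (simp add: rho_elem_def rhos_def el_Nil)

lemma xw_words: "1 \<le> p \<Longrightarrow> p < q \<Longrightarrow> q \<le> n \<Longrightarrow> xw p q \<in> W"
  by (simp add: words_def vj_gens_def)

lemma x_elem_carrier: "1 \<le> p \<Longrightarrow> p < q \<Longrightarrow> q \<le> n \<Longrightarrow> x_elem p q \<in> carrier (VJ n)"
  by (simp add: x_elem_def el_carrier xw_words)

section \<open>The symmetric group relations inside VJ_n and stabilizers of initial segments\<close>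

lemma rho_elem_square: "i \<in> {1..<n} \<Longrightarrow> rho_elem [i, i] = unit"
  using el_rel[OF vj_rels.s1[of i n]] by (auto simp: rho_elem_def rhos_def el_Nil)

lemma rho_elem_braid: "i \<in> {1..<n} \<Longrightarrow> Suc i \<in> {1..<n} \<Longrightarrow> rho_elem [i, Suc i, i] = rho_elem [Suc i, i, Suc i]"
  using el_rel[OF vj_rels.s2[of i n "Suc i"]] by (simp add: rho_elem_def rhos_def)

lemma rho_elem_commute:
  "i \<in> {1..<n} \<Longrightarrow> j \<in> {1..<n} \<Longrightarrow> Suc i < j \<or> Suc j < i \<Longrightarrow> rho_elem [i, j] = rho_elem [j, i]"
  using el_rel[OF vj_rels.s3[of i n j]] by (auto simp: rho_elem_def rhos_def)

lemma rho_elem_cong: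
  assumes "rho_elem b = rho_elem b'" "a \<in> I" "b \<in> I" "b' \<in> I" "c \<in> I"
  shows "rho_elem (a @ b @ c) = rho_elem (a @ b' @ c)"
proof -
  have "b @ c \<in> I" "b' @ c \<in> I" using assms by auto
  then show ?thesis using assms by (simp add: rho_elem_append)
qed

lemma rho_elem_rev_rho_elem: "is \<in> I \<Longrightarrow> rho_elem (rev is @ is) = unit"
proof (induction "is")
  case Nil
  then show ?case by (simp add: rho_elem_Nil)
next
  case (Cons i "is")
  then have "rho_elem (rev is @ [i, i] @ is) = rho_elem (rev is @ [] @ is)"
    by (intro rho_elem_cong) (auto simp: rho_elem_square rho_elem_Nil)
  then show ?case using Cons by simp
qed

lemma rho_elem_rev: "is \<in> I \<Longrightarrow> rho_elem (rev is) = inv\<^bsub>VJ n\<^esub> (rho_elem is)"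
proof -
  assume "is \<in> I"
  moreover from this have "rev is \<in> I" by auto
  ultimately show ?thesis
    using rho_elem_rev_rho_elem[of "is"] G.inv_equality[of "rho_elem (rev is)" "rho_elem is"] by (simp add: rho_elem_append rho_elem_carrier)
qed

lemma rho_elem_rho_elem_rev: "is \<in> I \<Longrightarrow> rho_elem (is @ rev is) = unit"
  using rho_elem_rev_rho_elem[of "rev is"] by auto

text \<open>The action yields this: in the state \<open>([y], [])\<close> the first component is a
  probe for the image of the single point \<open>y\<close>.\<close>

lemma perm_eq_of_rho_elem_eq:
  assumes "rho_elem is = rho_elem js" "is \<in> I" "js \<in> I"
  shows "perm is y = perm js y"
proof -
  have "pres_eq (vj_gens n) (vj_rels n) (rhos is) (rhos js)"
    by (rule el_eq_iff[OF rhos_words[OF assms(2)], THEN iffD1]) (use assms(1) in \<open>simp add: rho_elem_def\<close>)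
  then have "state_eq (act (rhos is) ([y], [])) (act (rhos js) ([y], []))"
    by (rule act_pres_eq) simp
  then show ?thesis by (simp add: act_rhos state_eq_def)
qed

lemma rho_elem_commute_list:
  assumes "ks \<in> I" "i \<in> {1..<n}" "\<forall>k\<in>set ks. Suc i < k \<or> Suc k < i"
  shows "rho_elem (ks @ [i]) = rho_elem (i # ks)"
  using assms
proof (induction ks)
  case (Cons k ks)
  then have "rho_elem ([k] @ (ks @ [i]) @ []) = rho_elem ([k] @ (i # ks) @ [])"
    by (intro rho_elem_cong) auto
  moreover have "rho_elem ([] @ [k, i] @ ks) = rho_elem ([] @ [i, k] @ ks)"
    using Cons.prems by (intro rho_elem_cong rho_elem_commute) auto
  ultimately show ?case by simp
qed simp

text \<open>The products \<open>\<rho>\<^sub>m \<cdots> \<rho>\<^sub>j\<^sub>-\<^sub>1\<close> represent the cosets of the parabolic subgroup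
  of \<open>S\<^sub>n\<close> fixing \<open>m\<close> in the one generated by \<open>\<rho>\<^sub>m, \<rho>\<^sub>m\<^sub>+\<^sub>1, \<dots>\<close>.\<close>

lemma coset_step:
  assumes "1 \<le> m" "m \<le> j" "j \<le> n" "m \<le> i" "i < n"
  shows "\<exists>ls\<in>idx (Suc m) n. \<exists>k. m \<le> k \<and> k \<le> n \<and> rho_elem ([m..<j] @ [i]) = rho_elem (ls @ [m..<k])"
proof -
  have mI: "[m..<k] \<in> I" if "k \<le> n" for k using that assms by auto
  consider "i = j" | "Suc i = j" | "j < i" | "Suc i < j" by linarith
  then show ?thesis
  proof cases
    case 1
    then show ?thesis using assms by (intro bexI[of _ "[]"] exI[of _ "Suc j"]) auto
  next
    case 2
    have "rho_elem ([m..<i] @ [i, i] @ []) = rho_elem ([m..<i] @ [] @ [])"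
      using assms by (intro rho_elem_cong) (auto simp: rho_elem_square rho_elem_Nil)
    then show ?thesis using assms 2 by (intro bexI[of _ "[]"] exI[of _ i]) auto
  next
    case 3
    have "rho_elem ([m..<j] @ [i]) = rho_elem (i # [m..<j])"
      using assms 3 by (intro rho_elem_commute_list mI) auto
    then show ?thesis using assms 3 by (intro bexI[of _ "[i]"] exI[of _ j]) auto
  next
    case 4
    \<comment> \<open>The final \<open>i\<close> commutes to the left past \<open>t\<close>, the
      braid relation turns \<open>i, Suc i, i\<close> into \<open>Suc i, i, Suc i\<close>, and the
      first \<open>Suc i\<close> commutes to the front.\<close>
    define t where "t = [Suc (Suc i)..<j]"
    have split: "[m..<j] = [m..<i] @ [i, Suc i] @ t"
      using upt_add_eq_append[of m i "j - i"] upt_conv_Cons[of i j] upt_conv_Cons[of "Suc i" j]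
        assms 4 by (simp add: t_def)
    have t: "t \<in> I" "[m..<i] \<in> I" using assms 4 by (auto simp: t_def)
    have i: "i \<in> {1..<n}" "Suc i \<in> {1..<n}" using assms 4 by auto
    have "rho_elem (([m..<i] @ [i, Suc i]) @ (t @ [i]) @ []) = rho_elem (([m..<i] @ [i, Suc i]) @ (i # t) @ [])"
      using t i by (intro rho_elem_cong rho_elem_commute_list) (auto simp: t_def)
    then have "rho_elem ([m..<j] @ [i]) = rho_elem ([m..<i] @ [i, Suc i, i] @ t)" by (simp add: split)
    also have "\<dots> = rho_elem ([m..<i] @ [Suc i, i, Suc i] @ t)"
      using t i by (intro rho_elem_cong rho_elem_braid) auto
    also have "\<dots> = rho_elem ([] @ ([m..<i] @ [Suc i]) @ [i, Suc i] @ t)" by simp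
    also have "\<dots> = rho_elem ([] @ (Suc i # [m..<i]) @ [i, Suc i] @ t)"
      using t i by (intro rho_elem_cong rho_elem_commute_list) auto
    finally have "rho_elem ([m..<j] @ [i]) = rho_elem ([Suc i] @ [m..<j])" by (simp add: split)
    then show ?thesis using assms 4 by (intro bexI[of _ "[Suc i]"] exI[of _ j]) auto
  qed
qed

text \<open>By \<open>coset_step\<close> the listed cosets are closed under right multiplication by
  generators, so every word lies in one of them.\<close>

lemma coset:
  assumes "1 \<le> m" "m \<le> n" "is \<in> idx m n"
  shows "\<exists>js\<in>idx (Suc m) n. \<exists>j. m \<le> j \<and> j \<le> n \<and> rho_elem is = rho_elem (js @ [m..<j])"
  using assms(3)
proof (induction "is" rule: rev_induct)
  case Nil
  then show ?case using assms by (intro bexI[of _ "[]"] exI[of _ m]) auto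
next
  case (snoc i "is")
  then obtain js j where js: "js \<in> idx (Suc m) n" "m \<le> j" "j \<le> n" "rho_elem is = rho_elem (js @ [m..<j])"
    by auto
  have i: "m \<le> i" "i < n" using snoc.prems by auto
  obtain ls k where ls: "ls \<in> idx (Suc m) n" "m \<le> k" "k \<le> n"
    "rho_elem ([m..<j] @ [i]) = rho_elem (ls @ [m..<k])"
    using coset_step[OF assms(1) js(2,3) i] by blast
  have I: "is \<in> I" "js \<in> I" "ls \<in> I" "[i] \<in> I" "[m..<j] \<in> I" "[m..<k] \<in> I"
    using assms snoc.prems js ls i by force+
  have "rho_elem ([] @ is @ [i]) = rho_elem ([] @ (js @ [m..<j]) @ [i])"
    using I js by (intro rho_elem_cong) auto
  also have "\<dots> = rho_elem (js @ ([m..<j] @ [i]) @ [])" by simp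
  also have "\<dots> = rho_elem (js @ (ls @ [m..<k]) @ [])"
    using I ls by (intro rho_elem_cong) auto
  finally have "rho_elem (is @ [i]) = rho_elem ((js @ ls) @ [m..<k])" by simp
  moreover have "js @ ls \<in> idx (Suc m) n" using js ls by auto
  ultimately show ?case using ls by blast
qed

text \<open>Induction on k with m = k + 1. A coset representative rho_m ... rho_{j-1} with j > m
  takes m to m + 1, and the remaining factor, which fixes m, cannot take m + 1 back to m; so the
  representative is empty. General \<open>k\<close> makes X_a well defined, and \<open>k = n\<close>
  shows that a rho-word inducing the identity is trivial in VJ_n.\<close>

lemma stabilizer:
  assumes "is \<in> I" "k \<le> n" "\<forall>y\<in>{1..k}. perm is y = y"
  shows "\<exists>js\<in>idx (Suc k) n. rho_elem is = rho_elem js"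
  using assms(2,3)
proof (induction k)
  case 0
  then show ?case using assms(1) by (intro bexI[of _ "is"]) auto
next
  case (Suc k)
  let ?m = "Suc k"
  obtain ks where ks: "ks \<in> idx ?m n" "rho_elem is = rho_elem ks" using Suc by force
  obtain js j where js: "js \<in> idx (Suc ?m) n" "?m \<le> j" "j \<le> n" "rho_elem ks = rho_elem (js @ [?m..<j])"
    using coset[of ?m ks] Suc.prems ks by auto
  have I: "js @ [?m..<j] \<in> I" using js by force
  have first: "perm ls ?m = ?m" if "ls \<in> idx (Suc ?m) n" for ls
    using that by (intro perm_fix) auto
  have "j = ?m"
  proof (rule ccontr)
    assume "j \<noteq> ?m"
    then have j: "[?m..<j] = ?m # [Suc ?m..<j]" using js by (simp add: upt_conv_Cons)
    have "perm (js @ [?m..<j]) ?m = ?m"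
      using perm_eq_of_rho_elem_eq[of "is" "js @ [?m..<j]" ?m] assms(1) I js ks Suc.prems by simp
    moreover have "perm (js @ [?m..<j]) ?m = perm js (Suc ?m)"
      using js first[of "[Suc ?m..<j]"] by (auto simp: perm_append j tr_def)
    ultimately have "perm js (Suc ?m) = perm js ?m" using first[OF js(1)] by simp
    then show False using bij_perm[of js] by (simp add: bij_def inj_eq)
  qed
  then show ?case using js ks by auto
qed

section \<open>Conjugation by rho-words and the elements X_a\<close>

definition cj :: "nat list \<Rightarrow> vj_gen word set \<Rightarrow> vj_gen word set"
  where "cj is g = rho_elem is \<cdot> g \<cdot> rho_elem (rev is)"

lemma rev_I: "is \<in> I \<Longrightarrow> rev is \<in> I"
  by auto

lemma cj_carrier: "is \<in> I \<Longrightarrow> g \<in> carrier (VJ n) \<Longrightarrow> cj is g \<in> carrier (VJ n)"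
  by (simp add: cj_def rho_elem_carrier)

lemma cj_append:
  "is \<in> I \<Longrightarrow> js \<in> I \<Longrightarrow> g \<in> carrier (VJ n) \<Longrightarrow> cj (is @ js) g = cj is (cj js g)"
  using rev_I[of "is"] rev_I[of js] by (simp add: cj_def rho_elem_append rho_elem_carrier G.m_assoc)

lemma cj_cong: "rho_elem is = rho_elem js \<Longrightarrow> is \<in> I \<Longrightarrow> js \<in> I \<Longrightarrow> cj is g = cj js g"
  by (simp add: cj_def rho_elem_rev)

lemma cj_mult:
  assumes "is \<in> I" "g \<in> carrier (VJ n)" "h \<in> carrier (VJ n)"
  shows "cj is (g \<cdot> h) = cj is g \<cdot> cj is h"
proof -
  have "rho_elem (rev is) \<cdot> (rho_elem is \<cdot> k) = k" if "k \<in> carrier (VJ n)" for k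
    using that assms(1) rho_elem_rev_rho_elem[OF assms(1)] rev_I[OF assms(1)]
    by (simp add: rho_elem_append rho_elem_carrier flip: G.m_assoc)
  then show ?thesis
    using assms rev_I[OF assms(1)] by (simp add: cj_def rho_elem_carrier G.m_assoc)
qed

lemma cj_commute:
  assumes "is \<in> I" "g \<in> carrier (VJ n)" "rho_elem is \<cdot> g = g \<cdot> rho_elem is"
  shows "cj is g = g"
  using assms rho_elem_rho_elem_rev[OF assms(1)] rev_I[OF assms(1)]
  by (simp add: cj_def rho_elem_append rho_elem_carrier G.m_assoc)

lemma cj_unit: "is \<in> I \<Longrightarrow> cj is unit = unit"
  using rho_elem_rho_elem_rev[of "is"] rev_I[of "is"] by (simp add: cj_def rho_elem_append rho_elem_carrier)

lemma rho_elem_x_elem_commute: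
  assumes "js \<in> idx (Suc k) n" "2 \<le> k" "k \<le> n"
  shows "rho_elem js \<cdot> x_elem 1 k = x_elem 1 k \<cdot> rho_elem js"
  using assms(1)
proof (induction js)
  case Nil
  then show ?case using assms x_elem_carrier[of 1 k] by (simp add: rho_elem_Nil)
next
  case (Cons i js)
  have i: "[i] \<in> I" "js \<in> I" using Cons.prems by auto
  have xc: "x_elem 1 k \<in> carrier (VJ n)" using assms by (intro x_elem_carrier) auto
  have "el (rhow i @ xw 1 k) = el (xw 1 k @ rhow i)"
    using Cons.prems assms by (intro el_rel vj_rels.m1) auto
  then have 1: "rho_elem [i] \<cdot> x_elem 1 k = x_elem 1 k \<cdot> rho_elem [i]"
    using el_append[of "rhow i" "xw 1 k"] el_append[of "xw 1 k" "rhow i"] rhos_words[OF i(1)]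
      xw_words[of 1 k] assms by (simp add: rho_elem_def x_elem_def rhos_def)
  have "rho_elem (i # js) \<cdot> x_elem 1 k = rho_elem [i] \<cdot> (rho_elem js \<cdot> x_elem 1 k)"
    using rho_elem_append[OF i] i xc by (simp add: rho_elem_carrier G.m_assoc)
  also have "\<dots> = rho_elem [i] \<cdot> x_elem 1 k \<cdot> rho_elem js"
    using Cons i xc by (simp add: rho_elem_carrier G.m_assoc)
  also have "\<dots> = x_elem 1 k \<cdot> rho_elem [i] \<cdot> rho_elem js" by (simp only: 1)
  also have "\<dots> = x_elem 1 k \<cdot> rho_elem (i # js)"
    using rho_elem_append[OF i] i xc by (simp add: rho_elem_carrier G.m_assoc)
  finally show ?case .
qed

text \<open>The element X_a. For \<open>a\<close> in \<open>seqs n\<close> the chosen word exists,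
  and \<open>seq_elem_perm\<close> shows that the choice does not matter.\<close>

definition seq_elem :: "nat list \<Rightarrow> vj_gen word set"
  where "seq_elem a = cj (SOME is. is \<in> I \<and> map (perm is) [1..<Suc (length a)] = a) (x_elem 1 (length a))"

text \<open>Two words carrying 1, ..., k to the same sequence differ by one that fixes 1, ..., k. By
  \<open>stabilizer\<close> the latter can be written with generators above \<open>k\<close>, which
  commute with \<open>x_elem 1 k\<close> by (m1).\<close>

lemma seq_elem_perm:
  assumes "is \<in> I" "2 \<le> k" "k \<le> n"
  shows "seq_elem (map (perm is) [1..<Suc k]) = cj is (x_elem 1 k)"
proof -
  define a where "a = map (perm is) [1..<Suc k]"
  have len: "length a = k" by (simp add: a_def)
  define js where "js = (SOME js. js \<in> I \<and> map (perm js) [1..<Suc k] = a)"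
  have "js \<in> I \<and> map (perm js) [1..<Suc k] = a"
    unfolding js_def by (rule someI[of _ "is"]) (use assms in \<open>simp add: len a_def del: upt_Suc\<close>)
  then have js: "js \<in> I" "map (perm js) [1..<Suc k] = map (perm is) [1..<Suc k]"
    by (auto simp: len a_def)
  have xc: "x_elem 1 k \<in> carrier (VJ n)" using assms by (intro x_elem_carrier) auto
  have rI: "rev js @ is \<in> I" using js assms by auto
  have "perm (rev js @ is) y = y" if "y \<in> {1..k}" for y
  proof -
    have "y \<in> set [1..<Suc k]" using that by auto
    then have "perm is y = perm js y" using js(2) unfolding map_eq_conv by metis
    then show ?thesis by (simp add: perm_append perm_rev_perm)
  qed
  then obtain ls where ls: "ls \<in> idx (Suc k) n" "rho_elem (rev js @ is) = rho_elem ls"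
    using stabilizer[OF rI assms(3)] by blast
  have lsI: "ls \<in> I" using ls by force
  have "cj (rev js @ is) (x_elem 1 k) = x_elem 1 k"
    using cj_cong[OF ls(2) rI lsI] cj_commute[OF lsI xc] rho_elem_x_elem_commute[OF ls(1) assms(2,3)] by simp
  then have "cj js (x_elem 1 k) = cj (js @ (rev js @ is)) (x_elem 1 k)"
    using cj_append[OF js(1) rI xc] by simp
  also have "\<dots> = cj is (x_elem 1 k)"
  proof (rule cj_cong)
    have "rho_elem ([] @ (js @ rev js) @ is) = rho_elem ([] @ [] @ is)"
      using js assms by (intro rho_elem_cong) (auto simp: rho_elem_Nil rho_elem_rho_elem_rev)
    then show "rho_elem (js @ rev js @ is) = rho_elem is" by simp
  qed (use js assms in auto)
  finally show ?thesis unfolding a_def[symmetric] seq_elem_def len js_def[symmetric] .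
qed

text \<open>Relation (m2) solved for its second generator; the inverse of the descending word is the
  ascending one.\<close>

lemma x_elem_shift:
  assumes "1 \<le> p" "p < q" "q < n"
  shows "x_elem (Suc p) (Suc q) = cj [p..<Suc q] (x_elem p q)"
proof -
  let ?d = "rev [p..<Suc q]"
  have I: "?d \<in> I" "[p..<Suc q] \<in> I" using assms by auto
  have xc: "x_elem p q \<in> carrier (VJ n)" "x_elem (Suc p) (Suc q) \<in> carrier (VJ n)"
    using assms by (auto intro: x_elem_carrier)
  have "el (xw p q @ rho_down q p) = el (rho_down q p @ xw (p + 1) (q + 1))"
    using assms by (intro el_rel vj_rels.m2)
  then have "el (xw p q @ rhos ?d) = el (rhos ?d @ xw (Suc p) (Suc q))"
    by (simp only: rho_down_rhos Suc_eq_plus1)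
  then have m2: "x_elem p q \<cdot> rho_elem ?d = rho_elem ?d \<cdot> x_elem (Suc p) (Suc q)"
    using el_append[OF xw_words rhos_words[OF I(1)], of p q] assms
      el_append[OF rhos_words[OF I(1)] xw_words, of "Suc p" "Suc q"]
    unfolding rho_elem_def x_elem_def by simp
  have "cj [p..<Suc q] (x_elem p q) = rho_elem [p..<Suc q] \<cdot> (rho_elem ?d \<cdot> x_elem (Suc p) (Suc q))"
    using I xc by (simp add: cj_def m2 rho_elem_carrier G.m_assoc del: upt_Suc)
  also have "\<dots> = rho_elem ([p..<Suc q] @ ?d) \<cdot> x_elem (Suc p) (Suc q)"
    using I xc by (simp add: rho_elem_append rho_elem_carrier G.m_assoc del: upt_Suc)
  also have "\<dots> = x_elem (Suc p) (Suc q)" using rho_elem_rho_elem_rev[OF I(2)] xc by simp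
  finally show ?thesis by simp
qed

text \<open>Iterated shifts. The images of 1, 2, ... are recorded so that the conjugating word can
  be recognised in \<open>seq_elem_perm\<close>.\<close>

lemma x_elem_from_first:
  assumes "1 \<le> p" "p < q" "q \<le> n"
  shows "\<exists>is\<in>I. x_elem p q = cj is (x_elem 1 (Suc q - p)) \<and> map (perm is) [1..<Suc (Suc q - p)] = [p..<Suc q]"
  using assms
proof (induction p arbitrary: q rule: nat_induct_at_least)
  case base
  then show ?case using x_elem_carrier[of 1 q]
    by (intro bexI[of _ "[]"]) (auto simp: cj_def rho_elem_Nil simp del: upt_Suc)
next
  case (Suc p)
  obtain t where q: "q = Suc t" using Suc.prems by (cases q) auto
  have pt: "1 \<le> p" "p < t" "t < n" using Suc q by auto
  let ?k = "Suc t - p"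
  obtain "is" where "is": "is \<in> I" "x_elem p t = cj is (x_elem 1 ?k)" "map (perm is) [1..<Suc ?k] = [p..<Suc t]"
    using Suc.IH[of t] pt by auto
  have I: "[p..<Suc t] \<in> I" using pt by auto
  have "x_elem (Suc p) q = cj ([p..<Suc t] @ is) (x_elem 1 ?k)"
    using x_elem_shift[OF pt] "is" I pt cj_append[OF I "is"(1), of "x_elem 1 ?k"] x_elem_carrier[of 1 ?k]
    by (simp add: q del: upt_Suc)
  moreover have "map (perm ([p..<Suc t] @ is)) [1..<Suc ?k] = [Suc p..<Suc q]"
  proof -
    have "map (perm ([p..<Suc t] @ is)) [1..<Suc ?k] =
        map (perm [p..<Suc t]) (map (perm is) [1..<Suc ?k])"
      by (simp add: perm_append del: upt_Suc)
    also have "\<dots> = map Suc [p..<Suc t]"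
    proof -
      have "perm [p..<Suc t] y = Suc y" if "y \<in> set [p..<Suc t]" for y
      proof -
        have "perm (rev [p..<Suc t]) (Suc y) = y" using that by (simp add: perm_down del: upt_Suc)
        then show ?thesis using perm_perm_rev[of "[p..<Suc t]" "Suc y"] by simp
      qed
      then show ?thesis unfolding "is"(3) map_eq_conv by blast
    qed
    finally show ?thesis by (simp add: map_Suc_upt q del: upt_Suc)
  qed
  moreover have "[p..<Suc t] @ is \<in> I" using I "is" by auto
  moreover have "Suc q - Suc p = ?k" by (simp add: q)
  ultimately show ?case by metis
qed

lemma seq_elem_interval:
  assumes "is \<in> I" "1 \<le> p" "p < q" "q \<le> n"
  shows "seq_elem (map (perm is) [p..<Suc q]) = cj is (x_elem p q)"
proof -
  let ?k = "Suc q - p"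
  obtain js where js: "js \<in> I" "x_elem p q = cj js (x_elem 1 ?k)" "map (perm js) [1..<Suc ?k] = [p..<Suc q]"
    using x_elem_from_first[OF assms(2-4)] by blast
  have "map (perm is) [p..<Suc q] = map (perm (is @ js)) [1..<Suc ?k]"
    by (simp add: perm_append js(3)[symmetric] del: upt_Suc)
  moreover have "is @ js \<in> I" using assms js by auto
  ultimately have "seq_elem (map (perm is) [p..<Suc q]) = cj (is @ js) (x_elem 1 ?k)"
    using seq_elem_perm[of "is @ js" ?k] assms by (simp del: upt_Suc)
  then show ?thesis using cj_append[OF assms(1) js(1), of "x_elem 1 ?k"] x_elem_carrier[of 1 ?k] assms js by simp
qed

section \<open>Square relations between the elements X_a\<close>

lemma seqsE:
  assumes "a \<in> seqs n"
  obtains js where "js \<in> I" "a = map (perm js) [1..<Suc (length a)]" "2 \<le> length a" "length a \<le> n"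
proof -
  have "length a \<le> n"
    using assms card_mono[of "{1..n}" "set a"] distinct_card[of a] by (auto simp: seqs_def)
  then show ?thesis using transitive[of a n] assms that by (auto simp: seqs_def simp del: upt_Suc)
qed

lemma seqs_map_perm: "is \<in> I \<Longrightarrow> a \<in> seqs n \<Longrightarrow> map (perm is) a \<in> seqs n"
proof -
  assume "is \<in> I" "a \<in> seqs n"
  moreover have "inj_on (perm is) (set a)"
    using bij_perm[of "is"] by (meson bij_is_inj inj_on_subset subset_UNIV)
  moreover have "perm is ` set a \<subseteq> {1..n}"
    using perm_range[OF \<open>is \<in> I\<close>] \<open>a \<in> seqs n\<close> by (auto simp: seqs_def)
  ultimately show ?thesis by (simp add: seqs_def distinct_map)
qed

lemma seq_elem_carrier: "a \<in> seqs n \<Longrightarrow> seq_elem a \<in> carrier (VJ n)"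
  by (erule seqsE) (metis One_nat_def seq_elem_perm cj_carrier x_elem_carrier le_refl Suc_1 Suc_le_lessD)

lemma seq_elem_conj:
  assumes "is \<in> I" "a \<in> seqs n"
  shows "cj is (seq_elem a) = seq_elem (map (perm is) a)"
proof -
  obtain js where js: "js \<in> I" "a = map (perm js) [1..<Suc (length a)]" "2 \<le> length a" "length a \<le> n"
    using assms(2) by (rule seqsE)
  let ?k = "length a"
  have xc: "x_elem 1 ?k \<in> carrier (VJ n)" using js by (intro x_elem_carrier) auto
  have "map (perm is) a = map (perm (is @ js)) [1..<Suc ?k]"
    by (subst js(2)) (simp add: perm_append del: upt_Suc)
  then have "seq_elem (map (perm is) a) = cj (is @ js) (x_elem 1 ?k)"
    using seq_elem_perm[of "is @ js" ?k] js assms by (simp del: upt_Suc)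
  moreover have "seq_elem a = cj js (x_elem 1 ?k)" using seq_elem_perm[of js ?k] js by simp
  ultimately show ?thesis using cj_append[OF assms(1) js(1) xc] by simp
qed

lemma seq_elem_involution: "a \<in> seqs n \<Longrightarrow> seq_elem a \<cdot> seq_elem a = unit"
proof (erule seqsE)
  fix js assume js: "js \<in> I" "a = map (perm js) [1..<Suc (length a)]" "2 \<le> length a" "length a \<le> n"
  let ?k = "length a"
  have xc: "x_elem 1 ?k \<in> carrier (VJ n)" using js by (intro x_elem_carrier) auto
  have "el (xw 1 ?k @ xw 1 ?k) = el []" using js by (intro el_rel vj_rels.j1) auto
  then have "x_elem 1 ?k \<cdot> x_elem 1 ?k = unit"
    using el_append[of "xw 1 ?k" "xw 1 ?k"] xw_words[of 1 ?k] js by (simp add: x_elem_def el_Nil)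
  moreover have "seq_elem a = cj js (x_elem 1 ?k)" using seq_elem_perm[of js ?k] js by simp
  ultimately show ?thesis using cj_mult[OF js(1) xc xc] cj_unit[OF js(1)] by simp
qed

text \<open>As \<open>a @ b\<close> is again a sequence of distinct elements, one permutation
  carries two adjacent initial intervals to \<open>a\<close> and \<open>b\<close>. The equation is
  therefore a conjugate of (j2).\<close>

lemma seq_elem_disjoint:
  assumes "a \<in> seqs n" "b \<in> seqs n" "set a \<inter> set b = {}"
  shows "seq_elem a \<cdot> seq_elem b = seq_elem b \<cdot> seq_elem a"
proof -
  let ?k = "length a" and ?l = "length b"
  have ab: "distinct (a @ b)" "set (a @ b) \<subseteq> {1..n}" "2 \<le> ?k" "2 \<le> ?l"
    using assms by (auto simp: seqs_def)
  then have len: "?k + ?l \<le> n"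
    using card_mono[of "{1..n}" "set (a @ b)"] distinct_card[of "a @ b"] by simp
  obtain js where js: "js \<in> I" "map (perm js) [1..<Suc (?k + ?l)] = a @ b"
    using transitive[OF ab(1,2)] by auto
  have "[1..<Suc (?k + ?l)] = [1..<Suc ?k] @ [Suc ?k..<Suc (?k + ?l)]"
    using upt_add_eq_append[of 1 "Suc ?k" ?l] by simp
  then have "map (perm js) [1..<Suc ?k] @ map (perm js) [Suc ?k..<Suc (?k + ?l)] = a @ b"
    using js(2) by (metis map_append)
  then have "map (perm js) [1..<Suc ?k] = a" "map (perm js) [Suc ?k..<Suc (?k + ?l)] = b"
    by (auto simp: append_eq_append_conv simp del: upt_Suc)
  then have seq_elem: "seq_elem a = cj js (x_elem 1 ?k)" "seq_elem b = cj js (x_elem (Suc ?k) (?k + ?l))"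
    using seq_elem_interval[OF js(1), of 1 ?k] seq_elem_interval[OF js(1), of "Suc ?k" "?k + ?l"] ab len by auto
  have xw: "xw 1 ?k \<in> W" "xw (Suc ?k) (?k + ?l) \<in> W" using ab len by (auto intro!: xw_words)
  have "el (xw 1 ?k @ xw (Suc ?k) (?k + ?l)) = el (xw (Suc ?k) (?k + ?l) @ xw 1 ?k)"
    using ab len by (intro el_rel vj_rels.j2) auto
  then have "x_elem 1 ?k \<cdot> x_elem (Suc ?k) (?k + ?l) = x_elem (Suc ?k) (?k + ?l) \<cdot> x_elem 1 ?k"
    using xw el_append[OF xw] el_append[OF xw(2,1)] by (simp add: x_elem_def)
  moreover have "x_elem 1 ?k \<in> carrier (VJ n)" "x_elem (Suc ?k) (?k + ?l) \<in> carrier (VJ n)"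
    using xw by (simp_all add: x_elem_def el_carrier)
  ultimately show ?thesis using seq_elem js(1) by (metis cj_mult)
qed

text \<open>A permutation carrying 1, ..., k to \<open>a\<close> carries a subinterval to the block
  \<open>b\<close>, and \<open>mirror\<close> commutes with permutations. The equation is therefore
  a conjugate of (j3).\<close>

lemma seq_elem_below:
  assumes "a \<in> seqs n" "b \<in> seqs n" "sublist b a"
  shows "seq_elem a \<cdot> seq_elem b = seq_elem (mirror a b) \<cdot> seq_elem a"
proof -
  let ?k = "length a"
  obtain js where js: "js \<in> I" "a = map (perm js) [1..<Suc ?k]" "2 \<le> ?k" "?k \<le> n"
    using assms(1) by (rule seqsE)
  obtain u v where a: "a = u @ b @ v" using assms(3) by (auto simp: sublist_def)
  define m where "m = Suc (length u)"
  define t where "t = length u + length b"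
  have b2: "2 \<le> length b" using assms by (simp add: seqs_def)
  have mt: "1 \<le> m" "m < t" "t \<le> ?k" using b2 by (auto simp: m_def t_def a)
  have "b = take (length b) (drop (length u) a)" by (simp add: a)
  also have "\<dots> = map (perm js) (take (length b) (drop (length u) [1..<Suc ?k]))"
    by (subst js(2)) (simp only: take_map drop_map)
  also have "take (length b) (drop (length u) [1..<Suc ?k]) = [m..<Suc t]"
    using mt by (simp add: drop_upt take_upt m_def t_def del: upt_Suc)
  finally have b: "b = map (perm js) [m..<Suc t]" .
  have "mirror a b = map (perm js) (mirror [1..<Suc ?k] [m..<Suc t])"
    by (subst js(2), subst b) (rule mirror_map, auto simp: bij_perm simp del: upt_Suc)
  then have mir: "mirror a b = map (perm js) [1 + ?k - t..<Suc (1 + ?k - m)]"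
    using mirror_interval[of 1 m t ?k] mt by simp
  have seq_elem: "seq_elem a = cj js (x_elem 1 ?k)" "seq_elem b = cj js (x_elem m t)"
    "seq_elem (mirror a b) = cj js (x_elem (1 + ?k - t) (1 + ?k - m))"
    using seq_elem_interval[OF js(1), of 1 ?k] seq_elem_interval[OF js(1), of m t] js mt b mir
      seq_elem_interval[OF js(1), of "1 + ?k - t" "1 + ?k - m"] by auto
  have xw: "xw 1 ?k \<in> W" "xw m t \<in> W" "xw (1 + ?k - t) (1 + ?k - m) \<in> W"
    using mt js by (auto intro!: xw_words)
  have "el (xw 1 ?k @ xw m t) = el (xw (1 + ?k - t) (1 + ?k - m) @ xw 1 ?k)"
    using mt js by (intro el_rel vj_rels.j3) auto
  then have "x_elem 1 ?k \<cdot> x_elem m t = x_elem (1 + ?k - t) (1 + ?k - m) \<cdot> x_elem 1 ?k"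
    using el_append[OF xw(1,2)] el_append[OF xw(3,1)] by (simp add: x_elem_def)
  moreover have "x_elem 1 ?k \<in> carrier (VJ n)" "x_elem m t \<in> carrier (VJ n)"
    "x_elem (1 + ?k - t) (1 + ?k - m) \<in> carrier (VJ n)"
    using xw by (simp_all add: x_elem_def el_carrier)
  ultimately show ?thesis using seq_elem js(1) by (metis cj_mult)
qed

lemma transport_seqs:
  assumes "a \<in> seqs n" "b \<in> seqs n"
  shows "transport a b \<in> seqs n"
proof (cases "sublist b a")
  case True
  then have "set (mirror a b) \<subseteq> set a"
    using assms by (intro set_mirror_subset set_mono_sublist) (auto simp: seqs_def)
  then show ?thesis
    using assms True by (auto simp: seqs_def transport_def distinct_mirror) (simp add: mirror_def)
qed (use assms in \<open>simp add: transport_def\<close>)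

lemma seq_elem_square:
  assumes "compatible a b" "a \<in> seqs n" "b \<in> seqs n"
  shows "seq_elem a \<cdot> seq_elem (transport a b) = seq_elem b \<cdot> seq_elem (transport b a)"
  using assms(1)
proof (cases rule: compatible_cases)
  case below
  have "distinct b" using assms by (simp add: seqs_def)
  have "mirror b a \<in> seqs n" using transport_seqs[OF assms(3,2)] below by (simp add: transport_def)
  moreover have "sublist (mirror b a) b" using below \<open>distinct b\<close> by (simp add: sublist_mirror_self)
  ultimately show ?thesis using seq_elem_below[OF assms(3), of "mirror b a"] below \<open>distinct b\<close>
    by (simp add: transport_def mirror_mirror)
next
  case above
  have "distinct a" using assms by (simp add: seqs_def)
  have "mirror a b \<in> seqs n" using transport_seqs[OF assms(2,3)] above by (simp add: transport_def)
  moreover have "sublist (mirror a b) a" using above \<open>distinct a\<close> by (simp add: sublist_mirror_self)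
  ultimately show ?thesis using seq_elem_below[OF assms(2), of "mirror a b"] above \<open>distinct a\<close>
    by (simp add: transport_def mirror_mirror)
next
  case disjoint
  then show ?thesis using seq_elem_disjoint assms by (simp add: transport_def)
qed

section \<open>Words of sequences as elements of VJ_n\<close>

primrec seqs_elem :: "nat list list \<Rightarrow> vj_gen word set" where
  "seqs_elem [] = unit"
| "seqs_elem (a # w) = seq_elem a \<cdot> seqs_elem w"

lemma seqs_elem_carrier: "w \<in> lists (seqs n) \<Longrightarrow> seqs_elem w \<in> carrier (VJ n)"
  by (induction w) (auto simp: seq_elem_carrier)

text \<open>Every square crossed by \<open>strip\<close> is an equation in the group, by
  \<open>seq_elem_square\<close>.\<close>

lemma seqs_elem_strip:
  assumes "seq.strip a w = Some v" "w \<in> lists (seqs n)" "a \<in> seqs n"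
  shows "v \<in> lists (seqs n)" and "seqs_elem w = seq_elem a \<cdot> seqs_elem v"
proof -
  have "v \<in> lists (seqs n) \<and> seqs_elem w = seq_elem a \<cdot> seqs_elem v"
    using assms
  proof (induction w arbitrary: a v)
    case (Cons b w)
    show ?case
    proof (cases "a = b")
      case True
      then show ?thesis using Cons.prems by auto
    next
      case False
      then obtain v' where C: "compatible a b" and v': "seq.strip (transport b a) w = Some v'"
        and v: "v = transport a b # v'"
        using Cons.prems(1) by (auto split: if_splits)
      have b: "b \<in> seqs n" and w: "w \<in> lists (seqs n)" using Cons.prems by auto
      note t = transport_seqs[OF Cons.prems(3) b] transport_seqs[OF b Cons.prems(3)]
      have IH: "v' \<in> lists (seqs n)" "seqs_elem w = seq_elem (transport b a) \<cdot> seqs_elem v'"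
        using Cons.IH[OF v' w t(2)] by auto
      have "seqs_elem (b # w) = seq_elem b \<cdot> seq_elem (transport b a) \<cdot> seqs_elem v'"
        using IH t b by (simp add: seqs_elem_carrier seq_elem_carrier G.m_assoc)
      also have "\<dots> = seq_elem a \<cdot> seq_elem (transport a b) \<cdot> seqs_elem v'"
        using seq_elem_square[OF C Cons.prems(3) b] by simp
      also have "\<dots> = seq_elem a \<cdot> seqs_elem v"
        using IH t Cons.prems(3) by (simp add: v seqs_elem_carrier seq_elem_carrier G.m_assoc)
      finally show ?thesis using v IH t by auto
    qed
  qed simp
  then show "v \<in> lists (seqs n)" "seqs_elem w = seq_elem a \<cdot> seqs_elem v" by auto
qed

lemma push_seqs:
  "a \<in> seqs n \<Longrightarrow> w \<in> lists (seqs n) \<Longrightarrow> seq.push a w \<in> lists (seqs n)"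
  by (auto simp: seq.push_def split: option.split dest: seqs_elem_strip(1))

lemma seqs_elem_push:
  assumes "a \<in> seqs n" "w \<in> lists (seqs n)"
  shows "seqs_elem (seq.push a w) = seq_elem a \<cdot> seqs_elem w"
proof (cases "seq.strip a w")
  case None
  then show ?thesis by (simp add: seq.push_def)
next
  case (Some v)
  note seqs_elem = seqs_elem_strip[OF Some assms(2,1)]
  have "seq_elem a \<cdot> seqs_elem w = seq_elem a \<cdot> seq_elem a \<cdot> seqs_elem v"
    using seqs_elem assms by (simp add: seqs_elem_carrier seq_elem_carrier G.m_assoc)
  also have "\<dots> = seqs_elem v" using seq_elem_involution[OF assms(1)] seqs_elem by (simp add: seqs_elem_carrier)
  finally show ?thesis using Some by (simp add: seq.push_def)
qed

lemma seqs_elem_conj: "is \<in> I \<Longrightarrow> w \<in> lists (seqs n) \<Longrightarrow> cj is (seqs_elem w) = seqs_elem (map (map (perm is)) w)"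
  by (induction w) (auto simp: cj_unit cj_mult seq_elem_carrier seqs_elem_carrier seq_elem_conj)

definition init_state :: state
  where "init_state = ([1..<Suc n], [])"

lemma el_letter:
  assumes "g \<in> vj_gens n"
  shows "el [(g, b)] = el [(g, True)]"
proof (cases b)
  case False
  have W: "[(g, c)] \<in> W" for c using assms by (simp add: words_def)
  have "el ([(g, True)] @ [(g, True)]) = el []"
  proof (cases g)
    case (GenX p q)
    then show ?thesis using assms by (intro el_rel) (auto simp: vj_gens_def intro: vj_rels.j1[simplified])
  next
    case (GenRho i)
    then show ?thesis using assms by (intro el_rel) (auto simp: vj_gens_def intro: vj_rels.s1[simplified])
  qed
  then have 1: "el [(g, True)] \<cdot> el [(g, True)] = unit" using W el_append[OF W W] el_Nil by metis
  have "el ([(g, False)] @ [(g, True)]) = el []"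
    using el_eq_iff[OF words_append[OF W W]] pres_eq.cancel[OF assms, of "vj_rels n" False] by simp
  then have "el [(g, False)] \<cdot> el [(g, True)] = unit" using W el_append[OF W W] el_Nil by metis
  with 1 show ?thesis using False el_carrier[OF W] G.inv_equality by metis
qed simp

text \<open>The state spells out a factorization of \<open>u\<close>. An x-letter is absorbed into
  the first factor by \<open>push\<close>; a rho-letter passes that factor by conjugation and joins
  the permutation.\<close>

lemma act_faithful:
  assumes "u \<in> W"
  shows "\<exists>is\<in>I. fst (act u init_state) = map (perm is) [1..<Suc n] \<and>
    snd (act u init_state) \<in> lists (seqs n) \<and> el u = seqs_elem (snd (act u init_state)) \<cdot> rho_elem is"
  using assms
proof (induction u)
  case Nil
  have "map (perm []) [1..<Suc n] = [1..<Suc n]" by (rule map_idI) simp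
  then show ?case
    by (intro bexI[of _ "[]"]) (simp_all add: act_Nil init_state_def el_Nil rho_elem_Nil del: upt_Suc)
next
  case (Cons l u)
  obtain g b where l: "l = (g, b)" by force
  obtain s w where st: "act u init_state = (s, w)" by force
  have u: "u \<in> W" and g: "g \<in> vj_gens n" using Cons.prems by (auto simp: words_def l)
  obtain "is" where "is": "is \<in> I" "s = map (perm is) [1..<Suc n]" "w \<in> lists (seqs n)"
    "el u = seqs_elem w \<cdot> rho_elem is"
    using Cons.IH[OF u] by (auto simp: st)
  have gW: "[(g, c)] \<in> W" for c using g by (simp add: words_def)
  have eu: "el (l # u) = el [(g, True)] \<cdot> (seqs_elem w \<cdot> rho_elem is)"
    using el_append[OF gW[of b] u] el_letter[OF g, of b] "is"(4) by (simp add: l)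
  show ?case
  proof (cases g)
    case (GenX p q)
    let ?a = "[p..<Suc q]"
    have pq: "1 \<le> p" "p < q" "q \<le> n" using g GenX by (auto simp: vj_gens_def)
    have a: "?a \<in> seqs n" using pq by (auto simp: seqs_def simp del: upt_Suc)
    have "map (perm []) ?a = ?a" by (rule map_idI) simp
    then have "seq_elem ?a = x_elem p q"
      using seq_elem_interval[of "[]" p q] pq x_elem_carrier[OF pq] by (simp add: cj_def rho_elem_Nil del: upt_Suc)
    then have "el (l # u) = seqs_elem (seq.push ?a w) \<cdot> rho_elem is"
      unfolding eu using seqs_elem_push[OF a "is"(3)] "is" a GenX x_elem_carrier[OF pq]
      by (simp add: x_elem_def seqs_elem_carrier seq_elem_carrier rho_elem_carrier G.m_assoc del: upt_Suc)
    then show ?thesis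
      using "is" push_seqs[OF a "is"(3)]
      by (intro bexI[of _ "is"]) (simp_all add: act_Cons l GenX st del: upt_Suc)
  next
    case (GenRho i)
    have i: "[i] \<in> I" "[i] @ is \<in> I" using g GenRho "is" by (auto simp: vj_gens_def)
    let ?w = "map (map (tr i)) w"
    have tr: "perm [i] = tr i" by (simp add: fun_eq_iff)
    have Ew: "seqs_elem w \<in> carrier (VJ n)" using "is" by (simp add: seqs_elem_carrier)
    have cj: "cj [i] (seqs_elem w) \<cdot> rho_elem [i] = rho_elem [i] \<cdot> seqs_elem w"
      using rho_elem_square[of i] i Ew rho_elem_append[of "[i]" "[i]"]
      by (simp add: cj_def rho_elem_carrier G.m_assoc)
    have "el [(g, True)] = rho_elem [i]" by (simp add: GenRho rho_elem_def rhos_def)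
    then have "el (l # u) = rho_elem [i] \<cdot> seqs_elem w \<cdot> rho_elem is"
      unfolding eu using Ew i "is" by (simp add: rho_elem_carrier G.m_assoc)
    also have "\<dots> = seqs_elem ?w \<cdot> rho_elem ([i] @ is)"
      using cj seqs_elem_conj[OF i(1) "is"(3)] i "is" rho_elem_append[OF i(1) "is"(1)] Ew cj_carrier[OF i(1) Ew]
      by (simp add: tr rho_elem_carrier flip: G.m_assoc)
    finally have 1: "el (l # u) = seqs_elem ?w \<cdot> rho_elem ([i] @ is)" .
    have "?w \<in> lists (seqs n)" using seqs_map_perm[OF i(1)] "is"(3) by (auto simp: tr)
    then show ?thesis
      using 1 i "is" by (intro bexI[of _ "[i] @ is"]) (simp_all add: act_Cons l GenRho st del: upt_Suc)
  qed
qed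

theorem el_unit_iff:
  assumes "u \<in> W"
  shows "el u = unit \<longleftrightarrow> act u init_state = ([1..<Suc n], [])"
proof
  assume "el u = unit"
  then have "pres_eq (vj_gens n) (vj_rels n) u []" using el_eq_iff[OF assms] el_Nil by metis
  then have "state_eq (act u init_state) (act [] init_state)"
    by (rule act_pres_eq) (simp add: init_state_def)
  \<comment> \<open>Only the empty word is equal to the empty word up to squares, so
    \<open>state_eq\<close> becomes equality of states.\<close>
  then show "act u init_state = ([1..<Suc n], [])"
    by (cases "act u init_state") (simp add: act_Nil init_state_def state_eq_def seq.sw_Nil_iff del: upt_Suc)
next
  assume act: "act u init_state = ([1..<Suc n], [])"
  then obtain "is" where "is": "is \<in> I" "map (perm is) [1..<Suc n] = [1..<Suc n]" "el u = unit \<cdot> rho_elem is"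
    using act_faithful[OF assms] by (auto simp del: upt_Suc)
  have "perm is y = y" if "y \<in> {1..n}" for y
  proof -
    have "map (perm is) [1..<Suc n] = map (\<lambda>y. y) [1..<Suc n]" using "is"(2) by simp
    then show ?thesis using that unfolding map_eq_conv by (simp del: upt_Suc)
  qed
  then obtain js where js: "js \<in> idx (Suc n) n" "rho_elem is = rho_elem js"
    using stabilizer[OF "is"(1) order_refl] by blast
  \<comment> \<open>The index range from \<open>Suc n\<close> to below \<open>n\<close> is
    empty.\<close>
  then have "js = []" by (cases js) auto
  then show "el u = unit" using "is" js by (simp add: rho_elem_Nil)
qed

end

section \<open>Computing the action\<close>

lemma comp_on_finite_fst:
  assumes "finite B" "inj_on e2 B" "\<And>b. b \<in> B \<Longrightarrow> comp_on D e1 e (\<lambda>x. F (b, x))"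
  shows "comp_on (B \<times> D) (pair_enc e2 e1) e F"
proof -
  have "comp_on (D \<times> B) (pair_enc e1 e2) e (\<lambda>p. F (snd p, fst p))"
    using comp_on_finite_snd[OF assms(1,2), of D e1 e "\<lambda>p. F (snd p, fst p)"] assms(3) by simp
  moreover have "comp_on (B \<times> D) (pair_enc e2 e1) (pair_enc e1 e2) (\<lambda>p. (snd p, fst p))"
    by (intro comp_on_pair comp_on_fst comp_on_snd)
  ultimately have "comp_on (B \<times> D) (pair_enc e2 e1) e
      (\<lambda>p. F (snd (snd p, fst p), fst (snd p, fst p)))"
    by (rule comp_on_comp) auto
  then show ?thesis by simp
qed

lemma comp_on_Cons_comp:
  assumes "comp_on D e e1 F" "comp_on D e (list_enc e1) G"
  shows "comp_on D e (list_enc e1) (\<lambda>x. F x # G x)"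
  using comp_on_comp[OF comp_on_Cons[of UNIV] comp_on_pair[OF assms]] by simp

lemma comp_on_fold_from:
  assumes "comp_on (S \<times> A) (pair_enc e1 e2) e1 (\<lambda>p. f (snd p) (fst p))"
    and "\<And>a s. a \<in> A \<Longrightarrow> s \<in> S \<Longrightarrow> f a s \<in> S" and "s0 \<in> S"
  shows "comp_on (lists A) (list_enc e2) e1 (\<lambda>xs. fold f xs s0)"
proof -
  have "comp_on (lists A) (list_enc e2) (pair_enc e1 (list_enc e2)) (\<lambda>xs. (s0, xs))"
    by (intro comp_on_pair comp_on_const comp_on_id)
  with comp_on_fold[OF assms(1,2)]
  have "comp_on (lists A) (list_enc e2) e1 (\<lambda>xs. fold f (snd (s0, xs)) (fst (s0, xs)))"
    by (rule comp_on_comp) (use assms(3) in auto)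
  then show ?thesis by simp
qed

lemma comp_on_map:
  assumes "comp_on A e1 e2 h"
  shows "comp_on (lists A) (list_enc e1) (list_enc e2) (map h)"
proof -
  have "comp_on (UNIV \<times> A) (pair_enc (list_enc e2) e1) e2 (\<lambda>p. h (snd p))"
    by (rule comp_on_comp[OF assms comp_on_snd]) auto
  then have "comp_on (UNIV \<times> A) (pair_enc (list_enc e2) e1) (list_enc e2) (\<lambda>p. h (snd p) # fst p)"
    by (rule comp_on_Cons_comp[OF _ comp_on_fst])
  then have "comp_on (lists A) (list_enc e1) (list_enc e2) (\<lambda>xs. fold (\<lambda>a ys. h a # ys) xs [])"
    by (rule comp_on_fold_from) auto
  then have "comp_on (lists A) (list_enc e1) (list_enc e2) (\<lambda>xs. rev (fold (\<lambda>a ys. h a # ys) xs []))"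
    by (rule comp_on_comp[OF comp_on_rev[of UNIV]]) auto
  moreover have "fold (\<lambda>a ys. h a # ys) xs ys = rev (map h xs) @ ys" for xs ys
    by (induction xs arbitrary: ys) auto
  ultimately show ?thesis by simp
qed

text \<open>
  The mode is \<open>Some (Some a)\<close> while the letter to be cancelled has been carried along as \<open>a\<close>,
  \<open>Some None\<close> once it has been cancelled, and \<open>None\<close> if it cannot be.
\<close>

type_synonym mode = "nat list option option"

text \<open>\<open>strip\<close> assembles its result while returning from the recursion. A left
  fold that emits the letters in reverse order does the same in a form to which
  \<open>comp_on_fold\<close> applies.\<close>

fun strip_step :: "nat list \<Rightarrow> mode \<times> nat list list \<Rightarrow> mode \<times> nat list list" where
  "strip_step b (None, out) = (None, out)"
| "strip_step b (Some None, out) = (Some None, b # out)"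
| "strip_step b (Some (Some a), out) = (if a = b then (Some None, out)
    else if compatible a b then (Some (Some (transport b a)), transport a b # out) else (None, out))"

lemma fold_strip_step:
  "fold strip_step w (None, out) = (None, out)"
  "fold strip_step w (Some None, out) = (Some None, rev w @ out)"
  by (induction w arbitrary: out) auto

text \<open>Failure can end in mode \<open>None\<close> or with a letter still being carried.
  Nothing is said about the output then, because \<open>push\<close> falls back on the original
  word.\<close>

lemma fold_strip_step_Some:
  "case seq.strip a w of
    Some v \<Rightarrow> fold strip_step w (Some (Some a), out) = (Some None, rev v @ out)
  | None \<Rightarrow> fst (fold strip_step w (Some (Some a), out)) \<noteq> Some None"
proof (induction w arbitrary: a out)
  case (Cons b w)
  show ?case
    using Cons[of "transport b a" "transport a b # out"]
    by (auto simp: fold_strip_step split: option.splits)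
qed simp

lemma push_fold:
  "seq.push a w = (if fst (fold strip_step w (Some (Some a), [])) = Some None
    then rev (snd (fold strip_step w (Some (Some a), []))) else a # w)"
  using fold_strip_step_Some[where a = a and w = w and out = "[]"]
  by (auto simp: seq.push_def split: option.splits)

lemma finite_seqs: "finite (seqs n)"
proof (rule finite_subset)
  show "seqs n \<subseteq> {xs. set xs \<subseteq> {1..n} \<and> length xs \<le> n}"
  proof
    fix a assume a: "a \<in> seqs n"
    then have "length a \<le> n" by (rule seqsE)
    with a show "a \<in> {xs. set xs \<subseteq> {1..n} \<and> length xs \<le> n}" by (simp add: seqs_def)
  qed
qed (simp add: finite_lists_length_le)

text \<open>\<open>to_nat\<close> is merely an injection. Operations that inspect letters, modes or
  value lists are computed on finite sets of them, where a table realizes any function.\<close>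

abbreviation letters_enc :: "nat list list \<Rightarrow> nat"
  where "letters_enc \<equiv> list_enc to_nat"

abbreviation state_enc :: "state \<Rightarrow> nat"
  where "state_enc \<equiv> pair_enc to_nat letters_enc"

lemma comp_on_push:
  assumes a: "a \<in> seqs n"
  shows "comp_on (lists (seqs n)) letters_enc letters_enc (seq.push a)"
proof -
  \<comment> \<open>The fold is a finite automaton with output: the carried letter stays in
    \<open>seqs n\<close>. For a fixed letter and mode, the new mode is constant and the output is
    kept or gets a fixed letter prepended.\<close>
  define M :: "mode set" where "M = {None, Some None} \<union> (\<lambda>a. Some (Some a)) ` seqs n"
  have finM: "finite M" by (simp add: M_def finite_seqs)
  let ?S = "M \<times> (UNIV :: nat list list set)" and ?es = "pair_enc to_nat letters_enc"
  have "comp_on (?S \<times> seqs n) (pair_enc ?es to_nat) ?es (\<lambda>p. strip_step (snd p) (fst p))"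
  proof (rule comp_on_finite_snd[OF finite_seqs inj_on_subset[OF inj_to_nat subset_UNIV]])
    fix b :: "nat list"
    show "comp_on ?S ?es ?es (\<lambda>x. strip_step (snd (x, b)) (fst (x, b)))"
    proof (rule comp_on_finite_fst[OF finM inj_on_subset[OF inj_to_nat subset_UNIV]])
      fix m :: mode
      have 1: "comp_on UNIV letters_enc ?es (\<lambda>out. (k, out))" for k :: mode
        by (intro comp_on_pair comp_on_const comp_on_id)
      have 2: "comp_on UNIV letters_enc ?es (\<lambda>out. (k, d # out))" for k :: mode and d
        by (intro comp_on_pair comp_on_const comp_on_Cons_comp comp_on_id)
      show "comp_on UNIV letters_enc ?es (\<lambda>x. strip_step (snd ((m, x), b)) (fst ((m, x), b)))"
      proof (cases m)
        case None
        then show ?thesis using 1 by simp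
      next
        case (Some k)
        then show ?thesis
        proof (cases k)
          case None
          then show ?thesis using Some 2 by simp
        next
          case k: (Some a)
          show ?thesis using Some k 1 2
            by (cases "a = b"; cases "compatible a b") simp_all
        qed
      qed
    qed
  qed
  moreover have "strip_step b s \<in> ?S" if "b \<in> seqs n" "s \<in> ?S" for b s
    using that transport_seqs[OF that(1)] by (auto simp: M_def)
  moreover have "(Some (Some a), []) \<in> ?S" using a by (simp add: M_def)
  ultimately have run: "comp_on (lists (seqs n)) letters_enc ?es
      (\<lambda>w. fold strip_step w (Some (Some a), []))"
    by (rule comp_on_fold_from)
  show ?thesis
    unfolding push_fold
  proof (rule comp_on_if_eq)
    show "comp_on (lists (seqs n)) letters_enc to_nat (\<lambda>w. fst (fold strip_step w (Some (Some a), [])))"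
      by (rule comp_on_comp[OF comp_on_fst[of UNIV] run]) simp
    show "comp_on (lists (seqs n)) letters_enc letters_enc
        (\<lambda>w. rev (snd (fold strip_step w (Some (Some a), []))))"
      by (rule comp_on_comp[OF comp_on_rev[of UNIV] comp_on_comp[OF comp_on_snd[of UNIV] run]]) simp_all
    show "comp_on (lists (seqs n)) letters_enc letters_enc (\<lambda>w. a # w)"
      by (intro comp_on_Cons_comp comp_on_const comp_on_id)
  qed (rule comp_on_const, rule inj_on_subset[OF inj_to_nat subset_UNIV])
qed

text \<open>An invariant under all generators whose first components form a finite set, so that a
  transposition acts on them by a table.\<close>

definition states :: "nat \<Rightarrow> state set"
  where "states n = {s. set s \<subseteq> {1..n} \<and> length s = n} \<times> lists (seqs n)"

lemma seqs_map_tr: "1 \<le> i \<Longrightarrow> i < n \<Longrightarrow> a \<in> seqs n \<Longrightarrow> map (tr i) a \<in> seqs n"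
proof -
  assume "1 \<le> i" "i < n" "a \<in> seqs n"
  moreover have "perm [i] = tr i" by (simp add: fun_eq_iff)
  ultimately show ?thesis using seqs_map_perm[of "[i]" n a] by simp
qed

lemma interval_seqs: "1 \<le> p \<Longrightarrow> p < q \<Longrightarrow> q \<le> n \<Longrightarrow> [p..<Suc q] \<in> seqs n"
  by (auto simp: seqs_def simp del: upt_Suc)

lemma act1_states:
  assumes "g \<in> vj_gens n" "st \<in> states n"
  shows "act1 g st \<in> states n"
proof -
  obtain s w where st: "st = (s, w)" by force
  show ?thesis
  proof (cases g)
    case (GenX p q)
    then show ?thesis using assms push_seqs[OF interval_seqs[of p q n], of w]
      by (auto simp: states_def vj_gens_def st simp del: upt_Suc)
  next
    case (GenRho i)
    then have i: "1 \<le> i" "i < n" using assms by (auto simp: vj_gens_def)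
    then have "map (tr i) s \<in> {s. set s \<subseteq> {1..n} \<and> length s = n}"
      using assms by (auto simp: states_def st tr_def transpose_def)
    moreover have "map (map (tr i)) w \<in> lists (seqs n)"
      using assms seqs_map_tr[OF i] by (auto simp: states_def st)
    ultimately show ?thesis by (simp add: states_def st GenRho)
  qed
qed

lemma comp_on_act1:
  assumes "g \<in> vj_gens n"
  shows "comp_on (states n) state_enc state_enc (act1 g)"
proof -
  have eta: "act1 g = (\<lambda>st. (fst (act1 g st), snd (act1 g st)))" by simp
  let ?P = "{s :: nat list. set s \<subseteq> {1..n} \<and> length s = n}"
  have fst: "comp_on (states n) state_enc to_nat fst" and snd: "comp_on (states n) state_enc letters_enc snd"
    by (rule comp_on_fst comp_on_snd)+
  have mem: "fst st \<in> ?P" "snd st \<in> lists (seqs n)" if "st \<in> states n" for st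
    using that by (auto simp: states_def)
  show ?thesis
  proof (cases g)
    case (GenX p q)
    have "comp_on (states n) state_enc letters_enc (\<lambda>st. seq.push [p..<Suc q] (snd st))"
      using assms GenX
      by (intro comp_on_comp[OF comp_on_push[OF interval_seqs] snd mem(2)]) (auto simp: vj_gens_def)
    then have "comp_on (states n) state_enc state_enc (\<lambda>st. (fst st, seq.push [p..<Suc q] (snd st)))"
      by (rule comp_on_pair[OF fst])
    moreover have "act1 g = (\<lambda>st. (fst st, seq.push [p..<Suc q] (snd st)))"
      by (rule ext) (auto simp: GenX simp del: upt_Suc)
    ultimately show ?thesis by simp
  next
    case (GenRho i)
    have "finite ?P" by (rule finite_lists_length_eq) simp
    then have "comp_on ?P to_nat to_nat (map (tr i))"
      by (rule comp_on_finite) (rule inj_on_subset[OF inj_to_nat subset_UNIV])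
    then have 1: "comp_on (states n) state_enc to_nat (\<lambda>st. map (tr i) (fst st))"
      by (rule comp_on_comp[OF _ fst mem(1)])
    have "comp_on (seqs n) to_nat to_nat (map (tr i))"
      by (rule comp_on_finite[OF finite_seqs inj_on_subset[OF inj_to_nat subset_UNIV]])
    then have "comp_on (lists (seqs n)) letters_enc letters_enc (map (map (tr i)))"
      by (rule comp_on_map)
    then have 2: "comp_on (states n) state_enc letters_enc (\<lambda>st. map (map (tr i)) (snd st))"
      by (rule comp_on_comp[OF _ snd mem(2)])
    have "act1 g = (\<lambda>st. (map (tr i) (fst st), map (map (tr i)) (snd st)))"
      by (rule ext) (auto simp: GenRho)
    then show ?thesis using comp_on_pair[OF 1 2] by simp
  qed
qed

definition letter_enc :: "vj_gen \<times> bool \<Rightarrow> nat"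
  where "letter_enc l = prod_encode (gen_code (fst l), of_bool (snd l))"

lemma word_code_list_enc: "word_code = list_enc letter_enc"
  by (simp add: fun_eq_iff word_code_def list_enc_def letter_enc_def[abs_def] case_prod_unfold)

lemma inj_letter_enc: "inj letter_enc"
proof (rule injI)
  fix l k :: "vj_gen \<times> bool"
  assume "letter_enc l = letter_enc k"
  then have "word_code [l] = word_code [k]" by (simp add: word_code_list_enc list_enc_def)
  then show "l = k" using word_code_inj by (auto dest: injD)
qed

lemma finite_vj_gens: "finite (vj_gens n)"
proof (rule finite_subset)
  show "vj_gens n \<subseteq> (\<lambda>(p, q). GenX p q) ` ({..n} \<times> {..n}) \<union> GenRho ` {..n}"
    by (auto simp: vj_gens_def)
qed simp

lemma comp_on_act: "comp_on (words (vj_gens n)) word_code state_enc (\<lambda>w. act w (init_state n))"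
proof -
  let ?L = "vj_gens n \<times> (UNIV :: bool set)" and ?f = "\<lambda>l. act1 (fst l)"
  have "comp_on (states n \<times> ?L) (pair_enc state_enc letter_enc) state_enc (\<lambda>p. ?f (snd p) (fst p))"
  proof (rule comp_on_finite_snd)
    show "finite ?L" by (simp add: finite_vj_gens)
    show "inj_on letter_enc ?L" by (rule inj_on_subset[OF inj_letter_enc]) simp
  qed (auto simp: comp_on_act1)
  then have "comp_on (lists ?L) (list_enc letter_enc) state_enc (\<lambda>w. fold ?f w (init_state n))"
  proof (rule comp_on_fold_from)
    show "init_state n \<in> states n" by (auto simp: states_def init_state_def simp del: upt_Suc)
  qed (auto simp: act1_states)
  \<comment> \<open>\<open>fold\<close> reads from the left, whereas the last letter has to act
    first.\<close>
  then have "comp_on (lists ?L) (list_enc letter_enc) state_enc (\<lambda>w. fold ?f (rev w) (init_state n))"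
    by (rule comp_on_comp[OF _ comp_on_rev]) auto
  then show ?thesis by (simp add: act_def foldr_conv_fold word_code_list_enc words_def)
qed

lemma inj_state_enc: "inj state_enc"
  by (rule injI) (auto simp: pair_enc_def list_enc_def list_encode_eq inj_map_eq_map prod_eq_iff)

theorem corollary3p8:
  fixes n :: nat
  assumes "n \<ge> 2"
  shows "\<exists>f. \<forall>w \<in> words (vj_gens n).
    rec_eval f [word_code w] (if vj_elem n w = \<one>\<^bsub>VJ n\<^esub> then 1 else 0)"
proof -
  \<comment> \<open>The program compares the code of the final state with that of the base state,
    which is a correct test because \<open>state_enc\<close> is injective.\<close>
  have "comp_on (words (vj_gens n)) word_code (\<lambda>k. k)
      (\<lambda>w. if act w (init_state n) = ([1..<Suc n], []) then 1 else 0)"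
    by (rule comp_on_if_eq[OF comp_on_act comp_on_const inj_on_subset[OF inj_state_enc subset_UNIV]
          comp_on_const comp_on_const])
  then obtain f where "\<forall>w\<in>words (vj_gens n). rec_eval f [word_code w]
      (if act w (init_state n) = ([1..<Suc n], []) then 1 else 0)"
    unfolding comp_on_def rec1_def by metis
  then show ?thesis using el_unit_iff by (intro exI[of _ f]) (simp del: upt_Suc)
qed

end
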